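(* Let $\mathbb{F}$ be an infinite NRC field, and let $n \geq 1$. Let $\mathcal{M}$ be an irreducible optimal weakly triangularizable subspace of $\mathrm{M}_n(\mathbb{F})$. Then $\mathcal{M}$ is similar to $\mathrm{S}_n(\mathbb{F})$ (if $n=1$ then simply $\mathcal{M}=\mathbb{F}=\mathrm{M}_1(\mathbb{F})$).
   Context: A field $\mathbb{F}$ is NRC when the map $x\in\mathbb{F}\mapsto x^2\in\mathbb{F}$ is nonsurjective. $\mathrm{M}_n(\mathbb{F})$ is the space of $n\times n$ matrices over $\mathbb{F}$ and $\mathrm{S}_n(\mathbb{F})$ its subspace of symmetric matrices. A linear subspace of $\mathrm{M}_n(\mathbb{F})$ is weakly triangularizable when all its elements are triangularizable over $\mathbb{F}$ (similar over $\mathbb{F}$ to an upper-triangular matrix). $t_n(\mathbb{F})$ is the greatest possible dimension of a weakly triangularizable linear subspace of $\mathrm{M}_n(\mathbb{F})$; such a subspace is optimal when its dimension equals $t_n(\mathbb{F})$. A linear subspace of $\mathrm{M}_n(\mathbb{F})$ is irreducible when no linear subspace of $\mathbb{F}^n$ other than $\{0\}$ and $\mathbb{F}^n$ is invariant under all its elements. Two subsets $\mathcal{X},\mathcal{Y}$ of $\mathrm{M}_n(\mathbb{F})$ are similar when $\mathcal{Y}=P\mathcal{X}P^{-1}$ for some $P\in \mathrm{GL}_n(\mathbb{F})$. *)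

theory Defs
  imports "Jordan_Normal_Form.VS_Connect"
begin

definition nrc_field :: "'a::field itself \<Rightarrow> bool" where
  "nrc_field _ \<longleftrightarrow> \<not> surj (\<lambda>x::'a. x ^ 2)"

definition mat_subspace :: "nat \<Rightarrow> 'a::field mat set \<Rightarrow> bool" where
  "mat_subspace n V \<longleftrightarrow> VectorSpace.subspace class_ring V (module_mat TYPE('a) n n)"

definition mat_subspace_dim :: "nat \<Rightarrow> 'a::field mat set \<Rightarrow> nat" where
  "mat_subspace_dim n V = vectorspace.dim class_ring ((module_mat TYPE('a) n n)\<lparr>carrier := V\<rparr>)"

definition triangularizable :: "'a::field mat \<Rightarrow> bool" where
  "triangularizable A \<longleftrightarrow> (\<exists>T. similar_mat A T \<and> upper_triangular T)"

definition weakly_triangularizable :: "nat \<Rightarrow> 'a::field mat set \<Rightarrow> bool" where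
  "weakly_triangularizable n V \<longleftrightarrow> mat_subspace n V \<and> (\<forall>A\<in>V. triangularizable A)"

text \<open>The maximum below exists: the zero space is weakly triangularizable, and all dimensions
  are at most \<open>n * n\<close>.\<close>

definition max_triang_dim :: "'a::field itself \<Rightarrow> nat \<Rightarrow> nat" where
  "max_triang_dim _ n =
     (GREATEST d. \<exists>V :: 'a mat set. weakly_triangularizable n V \<and> mat_subspace_dim n V = d)"

definition optimal_weakly_triangularizable :: "nat \<Rightarrow> 'a::field mat set \<Rightarrow> bool" where
  "optimal_weakly_triangularizable n V \<longleftrightarrow>
     weakly_triangularizable n V \<and> mat_subspace_dim n V = max_triang_dim TYPE('a) n"

definition irreducible_mat_space :: "nat \<Rightarrow> 'a::field mat set \<Rightarrow> bool" where
  "irreducible_mat_space n V \<longleftrightarrow>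
     mat_subspace n V \<and>
     (\<forall>W. VectorSpace.subspace class_ring W (module_vec TYPE('a) n) \<and>
          (\<forall>A\<in>V. \<forall>w\<in>W. A *\<^sub>v w \<in> W) \<longrightarrow> W = {0\<^sub>v n} \<or> W = carrier_vec n)"

definition symmetric_mats :: "nat \<Rightarrow> 'a::field mat set" where
  "symmetric_mats n = {A \<in> carrier_mat n n. transpose_mat A = A}"

definition similar_mat_sets :: "nat \<Rightarrow> 'a::field mat set \<Rightarrow> 'a mat set \<Rightarrow> bool" where
  "similar_mat_sets n X Y \<longleftrightarrow>
     (\<exists>P \<in> carrier_mat n n. \<exists>Q \<in> carrier_mat n n.
        P * Q = 1\<^sub>m n \<and> Q * P = 1\<^sub>m n \<and> Y = (\<lambda>A. P * A * Q) ` X)"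

end

theory Submission
  imports Defs "HOL-Library.Function_Algebras"
begin

text \<open>
  Let \<open>V\<close> be the given space of \<open>n \<times> n\<close> matrices and let
  \<open>perp\<close> be its orthogonal for the pairing \<open>(A, N) \<mapsto> tr (A N)\<close>. A
  rank-one matrix \<open>x f\<close> (the map \<open>v \<mapsto> f(v) x\<close>) lies in
  \<open>V\<close> exactly if the linear form \<open>f\<close> vanishes on \<open>perp x\<close>, so
  the rank-one elements of \<open>V\<close> are governed by the spaces \<open>perp x\<close>.
  Triangularizability enters only through invariant subspaces \<open>E \<subset> F\<close>: the
  operator has an eigenvector in \<open>F / E\<close>. In particular, if it exchanges two lines of a
  plane modulo \<open>E\<close>, with factors \<open>a\<close> and \<open>c\<close>, then \<open>a
  c\<close> is a square (\<open>flag_split_plane\<close>); the absence of square roots is used by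
  making \<open>a c\<close> a fixed non-square.

  \<^bold>\<open>Good vectors.\<close> For every subspace \<open>Q\<close> some \<open>x\<close> is
  good for \<open>Q\<close>, which means that \<open>V\<close> contains no operator that modulo
  \<open>Q\<close> is a nonzero nilpotent of rank one with range spanned by \<open>x\<close>
  (\<open>ex_good\<close>): otherwise some combination of two such operators, with ranges spanned by
  independent vectors, would exchange the lines of these vectors with a non-square product of factors.
  Choosing good vectors one after the other gives a basis in which \<open>V\<close> contains no
  nonzero strictly upper triangular matrix. Hence \<open>dim V \<le> n (n + 1) / 2\<close>, and since
  the upper triangular matrices attain this value, an optimal \<open>V\<close> is a complement of the
  strictly upper triangular matrices in each such basis. Two consequences follow: \<open>V\<close>
  contains the identity (\<open>idmat_in_V\<close>), and every good vector \<open>x\<close> carries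
  exactly one form \<open>psi x\<close> with value \<open>1\<close> at \<open>x\<close> for which
  \<open>x (psi x)\<close> lies in \<open>V\<close> (\<open>good_idempotent\<close>).

  \<^bold>\<open>Irreducibility.\<close> The common kernel of all forms \<open>psi x\<close> is
  invariant under \<open>V\<close>: if \<open>A y = w\<close> left it, then \<open>V\<close> would
  contain an operator that kills the common kernel and has a prescribed value at \<open>w\<close>, and
  adding it to \<open>A\<close> would produce an operator that exchanges the lines of \<open>y\<close>
  and \<open>w\<close> (\<open>common_kernel_invariant\<close>). So an irreducible \<open>V\<close>
  has trivial common kernel.

  \<^bold>\<open>Gluing.\<close> For good vectors \<open>x\<close>, \<open>z\<close> in general
  position the two functionals \<open>psi x (N z)\<close> and \<open>psi z (N x)\<close> of \<open>N
  \<in> perp\<close> are proportional (\<open>pair_relation\<close>). Thus \<open>psi\<close> is, up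
  to scalars, linear on generic lines, and rescaling over a generic basis yields one nondegenerate
  bilinear form \<open>b\<close>, with matrix \<open>G\<close>, such that \<open>b(x, N x) = 0\<close>
  for all \<open>x\<close> and all \<open>N \<in> perp\<close> (\<open>ex_form\<close>).

  \<^bold>\<open>Conclusion.\<close> Consequently \<open>V\<close> contains all products \<open>S
  G\<close> with \<open>S\<close> symmetric, and by dimension it consists of them. As the identity is
  such a product, \<open>G\<close> is symmetric. The plane argument excludes hyperbolic pairs of
  \<open>b\<close>, so \<open>b\<close> has an orthogonal basis in every characteristic, and the same
  argument shows that the products \<open>b(p, p) b(q, q)\<close> of its diagonal values are squares.
  After rescaling, \<open>b\<close> is a multiple of the standard form, and in the corresponding basis
  \<open>V\<close> becomes the space of symmetric matrices.

  Zariski density is replaced throughout by an elementary substitute: a condition that holds at one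
  point of a line holds at all but finitely many points of it (\<open>full_line_open\<close>), and the
  ground field is infinite.
\<close>

section \<open>Spaces of finitely supported functions\<close>

definition fscale :: "'a::field \<Rightarrow> ('i \<Rightarrow> 'a) \<Rightarrow> 'i \<Rightarrow> 'a" (infixr "*f" 75)
  where "c *f f = (\<lambda>i. c * f i)"

lemma fscale_apply: "(c *f f) i = c * f i"
  by (simp add: fscale_def)

lemma sum_fun_apply: "(\<Sum>k\<in>K. f k) i = (\<Sum>k\<in>K. f k i :: 'a::comm_monoid_add)"
  by (induction K rule: infinite_finite_induct) auto

lemmas pointwise = plus_fun_apply zero_fun_apply minus_apply uminus_apply fscale_apply sum_fun_apply

text \<open>As simplification rules these would also rewrite unapplied sums of functions into abstractions.\<close>

declare plus_fun_apply [simp del] zero_fun_apply [simp del] minus_apply [simp del] uminus_apply [simp del]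

global_interpretation fs: vector_space "fscale :: 'a::field \<Rightarrow> ('i \<Rightarrow> 'a) \<Rightarrow> 'i \<Rightarrow> 'a"
  by unfold_locales (auto simp: fun_eq_iff pointwise algebra_simps)

text \<open>The functions vanishing outside \<open>I\<close> stand for coordinate spaces: vectors and matrices of
  all sizes then live in one type each, so that spans and dimensions are those of a single vector
  space.\<close>

definition supp_on :: "'i set \<Rightarrow> ('i \<Rightarrow> 'a::field) set"
  where "supp_on I = {f. \<forall>i. i \<notin> I \<longrightarrow> f i = 0}"

definition unit_fun :: "'i \<Rightarrow> 'i \<Rightarrow> 'a::field"
  where "unit_fun i = (\<lambda>j. if j = i then 1 else 0)"

lemma inj_unit_fun: "inj (unit_fun :: 'i \<Rightarrow> 'i \<Rightarrow> 'a::field)"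
  by (rule injI) (metis unit_fun_def zero_neq_one)

lemma subspace_supp_on: "fs.subspace (supp_on I)"
  by (auto simp: fs.subspace_def supp_on_def pointwise)

lemma unit_fun_supp_on: "i \<in> I \<Longrightarrow> unit_fun i \<in> supp_on I"
  by (auto simp: supp_on_def unit_fun_def)

lemma supp_on_expand:
  assumes "finite I" "f \<in> supp_on I"
  shows "f = (\<Sum>i\<in>I. f i *f unit_fun i)"
  using assms by (auto simp: fun_eq_iff pointwise supp_on_def unit_fun_def if_distrib sum.delta cong: if_cong)

lemma span_unit_funs:
  assumes "finite I"
  shows "fs.span (unit_fun ` I) = (supp_on I :: ('i \<Rightarrow> 'a::field) set)"
proof
  show "fs.span (unit_fun ` I) \<subseteq> (supp_on I :: ('i \<Rightarrow> 'a) set)"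
    by (rule fs.span_minimal) (auto simp: unit_fun_supp_on subspace_supp_on)
  show "(supp_on I :: ('i \<Rightarrow> 'a) set) \<subseteq> fs.span (unit_fun ` I)"
  proof
    fix f :: "'i \<Rightarrow> 'a" assume "f \<in> supp_on I"
    then have "f = (\<Sum>i\<in>I. f i *f unit_fun i)" using supp_on_expand assms by blast
    also have "\<dots> \<in> fs.span (unit_fun ` I)"
      by (intro fs.span_sum fs.span_scale fs.span_base) auto
    finally show "f \<in> fs.span (unit_fun ` I)" .
  qed
qed

lemma independent_unit_funs:
  fixes I :: "'i set"
  assumes "finite I"
  shows "fs.independent (unit_fun ` I :: ('i \<Rightarrow> 'a::field) set)"
proof (rule fs.independent_if_scalars_zero)
  show "finite (unit_fun ` I :: ('i \<Rightarrow> 'a) set)" using assms by simp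
  have inj: "inj_on (unit_fun :: 'i \<Rightarrow> 'i \<Rightarrow> 'a) I"
    by (rule inj_on_subset[OF inj_unit_fun]) simp
  fix g :: "('i \<Rightarrow> 'a) \<Rightarrow> 'a" and x :: "'i \<Rightarrow> 'a"
  assume s: "(\<Sum>x\<in>unit_fun ` I. g x *f x) = 0" and x: "x \<in> unit_fun ` I"
  then obtain i where i: "i \<in> I" "x = unit_fun i" by auto
  have "0 = (\<Sum>x\<in>unit_fun ` I. g x *f x) i" using s by (simp add: pointwise)
  also have "\<dots> = (\<Sum>k\<in>I. g (unit_fun k) * unit_fun k i)"
    by (simp add: pointwise sum.reindex[OF inj])
  also have "\<dots> = g x"
    using assms i by (simp add: unit_fun_def if_distrib sum.delta cong: if_cong)
  finally show "g x = 0" by simp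
qed

lemma card_unit_funs: "card (unit_fun ` I :: ('i \<Rightarrow> 'a::field) set) = card I"
  by (rule card_image) (rule inj_on_subset[OF inj_unit_fun], simp)

lemma finite_independent_supp_on:
  assumes "finite I" "fs.independent B" "B \<subseteq> supp_on I"
  shows "finite B \<and> card B \<le> card I"
  using fs.independent_span_bound[of "unit_fun ` I" B] assms
  by (metis card_unit_funs finite_imageI span_unit_funs)

lemma dim_supp_on:
  assumes "finite I" shows "fs.dim (supp_on I :: ('i \<Rightarrow> 'a::field) set) = card I"
  using fs.dim_span_eq_card_independent[OF independent_unit_funs[OF assms]]
  by (simp add: span_unit_funs[OF assms] card_unit_funs)

lemma full_dim_supp_on:
  fixes X :: "('i \<Rightarrow> 'a::field) set"
  assumes I: "finite I" and X: "fs.subspace X" "X \<subseteq> supp_on I" and d: "card I \<le> fs.dim X"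
  shows "X = supp_on I"
proof
  obtain B where B: "B \<subseteq> X" "fs.independent B" "X \<subseteq> fs.span B" "card B = fs.dim X"
    by (rule fs.basis_exists)
  show "supp_on I \<subseteq> X"
  proof (rule ccontr)
    assume "\<not> supp_on I \<subseteq> X"
    then obtain f where f: "f \<in> supp_on I" "f \<notin> X" by auto
    have "fs.span B \<subseteq> X" using B(1) X(1) fs.span_minimal by blast
    then have fs: "f \<notin> fs.span B" using f by auto
    have ind: "fs.independent (insert f B)" by (rule fs.independent_insertI[OF fs B(2)])
    have nB: "f \<notin> B" using fs fs.span_base by blast
    have fB: "finite B" using finite_independent_supp_on[OF I B(2)] B(1) X(2) by blast
    have "card (insert f B) \<le> card I"
      using finite_independent_supp_on[OF I ind] B(1) X(2) f by blast
    then show False using nB fB d B(4) by simp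
  qed
qed (fact X(2))

text \<open>Extending a basis of \<open>X\<close> by \<open>v\<close> allows a functional to be prescribed as
  \<open>0\<close> on \<open>X\<close> and \<open>1\<close> at \<open>v\<close>; on functions with
  finite support it is given by its values on the unit functions.\<close>

lemma separating_functional:
  fixes X :: "('i \<Rightarrow> 'a::field) set"
  assumes I: "finite I" and X: "fs.subspace X" "X \<subseteq> supp_on I" and v: "v \<in> supp_on I" "v \<notin> X"
  obtains g where "g \<in> supp_on I" "\<And>x. x \<in> X \<Longrightarrow> (\<Sum>i\<in>I. g i * x i) = 0" "(\<Sum>i\<in>I. g i * v i) \<noteq> 0"
proof -
  interpret p: vector_space_pair "fscale :: 'a \<Rightarrow> ('i \<Rightarrow> 'a) \<Rightarrow> 'i \<Rightarrow> 'a" "(*) :: 'a \<Rightarrow> 'a \<Rightarrow> 'a"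
    by unfold_locales (simp_all add: distrib_left distrib_right)
  obtain B where B: "B \<subseteq> X" "fs.independent B" "X \<subseteq> fs.span B"
    by (rule fs.basis_exists)
  have "fs.span B \<subseteq> X" using B(1) X(1) fs.span_minimal by blast
  then have vs: "v \<notin> fs.span B" using v by auto
  have ind: "fs.independent (insert v B)" by (rule fs.independent_insertI[OF vs B(2)])
  have vB: "v \<notin> B" using vs fs.span_base by blast
  from p.linear_independent_extend[OF ind, of "\<lambda>x. if x = v then 1 else 0"]
  obtain f where f: "Vector_Spaces.linear fscale (*) f"
    and fB': "\<forall>x\<in>insert v B. f x = (if x = v then 1 else 0 :: 'a)"
    by (elim exE conjE)
  note fB = bspec[OF fB']
  interpret f: Vector_Spaces.linear fscale "(*)" f by (rule f)
  define g where "g = (\<lambda>i. if i \<in> I then f (unit_fun i) else 0)"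
  have fg: "f x = (\<Sum>i\<in>I. g i * x i)" if "x \<in> supp_on I" for x
  proof -
    have "f x = f (\<Sum>i\<in>I. x i *f unit_fun i)"
      by (rule arg_cong[OF supp_on_expand[OF I that]])
    also have "\<dots> = (\<Sum>i\<in>I. g i * x i)"
      by (simp add: f.sum f.scale g_def mult.commute)
    finally show ?thesis .
  qed
  have fX: "f x = 0" if "x \<in> X" for x
  proof -
    have "fs.subspace {x. f x = 0}"
      by (rule fs.subspaceI) (simp_all only: mem_Collect_eq f.zero f.add f.scale mult_zero_right add_0_right)
    moreover have "B \<subseteq> {x. f x = 0}" using fB vB by auto
    ultimately have "fs.span B \<subseteq> {x. f x = 0}" by (rule fs.span_minimal[rotated])
    then show ?thesis using B(3) that by auto
  qed
  have fv: "f v = 1" using fB by simp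
  show thesis
  proof (rule that)
    show "g \<in> supp_on I" by (auto simp: supp_on_def g_def)
    show "(\<Sum>i\<in>I. g i * x i) = 0" if "x \<in> X" for x
      using fg[of x] fX[OF that] X(2) that by auto
    show "(\<Sum>i\<in>I. g i * v i) \<noteq> 0"
      using fg[OF v(1)] fv by simp
  qed
qed

section \<open>Vectors, square matrices and the trace pairing\<close>

abbreviation vecs :: "nat \<Rightarrow> (nat \<Rightarrow> 'a::field) set"
  where "vecs n \<equiv> supp_on {..<n}"

abbreviation mats :: "nat \<Rightarrow> (nat \<times> nat \<Rightarrow> 'a::field) set"
  where "mats n \<equiv> supp_on ({..<n} \<times> {..<n})"

definition dot :: "nat \<Rightarrow> (nat \<Rightarrow> 'a::field) \<Rightarrow> (nat \<Rightarrow> 'a) \<Rightarrow> 'a"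
  where "dot n x y = (\<Sum>i<n. x i * y i)"

definition app :: "nat \<Rightarrow> (nat \<times> nat \<Rightarrow> 'a::field) \<Rightarrow> (nat \<Rightarrow> 'a) \<Rightarrow> nat \<Rightarrow> 'a"
  where "app n A x = (\<lambda>i. \<Sum>j<n. A (i, j) * x j)"

definition pairing :: "nat \<Rightarrow> (nat \<times> nat \<Rightarrow> 'a::field) \<Rightarrow> (nat \<times> nat \<Rightarrow> 'a) \<Rightarrow> 'a"
  where "pairing n A N = (\<Sum>i<n. \<Sum>j<n. A (i, j) * N (j, i))"

definition outer :: "(nat \<Rightarrow> 'a::field) \<Rightarrow> (nat \<Rightarrow> 'a) \<Rightarrow> nat \<times> nat \<Rightarrow> 'a"
  where "outer x f = (\<lambda>(i, j). x i * f j)"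

definition idmat :: "nat \<Rightarrow> nat \<times> nat \<Rightarrow> 'a::field"
  where "idmat n = (\<lambda>(i, j). if i = j \<and> i < n then 1 else 0)"

lemma vecs_closed [simp, intro]:
  "0 \<in> vecs n" "x \<in> vecs n \<Longrightarrow> y \<in> vecs n \<Longrightarrow> x + y \<in> vecs n"
  "x \<in> vecs n \<Longrightarrow> y \<in> vecs n \<Longrightarrow> x - y \<in> vecs n" "x \<in> vecs n \<Longrightarrow> c *f x \<in> vecs n"
  by (auto simp: supp_on_def pointwise)

lemma mats_closed [simp, intro]:
  "0 \<in> mats n" "A \<in> mats n \<Longrightarrow> B \<in> mats n \<Longrightarrow> A + B \<in> mats n"
  "A \<in> mats n \<Longrightarrow> B \<in> mats n \<Longrightarrow> A - B \<in> mats n" "A \<in> mats n \<Longrightarrow> c *f A \<in> mats n"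
  by (auto simp: supp_on_def pointwise)

lemma dot_linear [simp]:
  "dot n (x + y) z = dot n x z + dot n y z" "dot n z (x + y) = dot n z x + dot n z y"
  "dot n (x - y) z = dot n x z - dot n y z" "dot n z (x - y) = dot n z x - dot n z y"
  "dot n (c *f x) z = c * dot n x z" "dot n z (c *f x) = c * dot n z x"
  "dot n 0 z = 0" "dot n z 0 = 0"
  by (simp_all add: dot_def pointwise algebra_simps sum.distrib sum_subtractf sum_distrib_left)

lemma dot_sum: "dot n z (\<Sum>k\<in>K. f k) = (\<Sum>k\<in>K. dot n z (f k))"
  "dot n (\<Sum>k\<in>K. f k) z = (\<Sum>k\<in>K. dot n (f k) z)"
  by (induction K rule: infinite_finite_induct) auto

lemma dot_commute: "dot n x y = dot n y x"
  by (simp add: dot_def mult.commute)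

lemma app_linear [simp]:
  "app n (A + B) z = app n A z + app n B z" "app n A (x + y) = app n A x + app n A y"
  "app n (A - B) z = app n A z - app n B z" "app n A (x - y) = app n A x - app n A y"
  "app n (c *f A) z = c *f app n A z" "app n A (c *f x) = c *f app n A x"
  "app n 0 z = 0" "app n A 0 = 0"
  by (simp_all add: fun_eq_iff pointwise app_def algebra_simps sum.distrib sum_subtractf sum_distrib_left)

lemma app_sum: "app n A (\<Sum>k\<in>K. f k) = (\<Sum>k\<in>K. app n A (f k))"
  by (induction K rule: infinite_finite_induct) auto

lemma app_in_vecs [simp, intro]: "A \<in> mats n \<Longrightarrow> app n A x \<in> vecs n"
  by (auto simp: supp_on_def app_def)

lemma pairing_linear [simp]:
  "pairing n (A + B) N = pairing n A N + pairing n B N"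
  "pairing n N (A + B) = pairing n N A + pairing n N B"
  "pairing n (A - B) N = pairing n A N - pairing n B N"
  "pairing n N (A - B) = pairing n N A - pairing n N B"
  "pairing n (c *f A) N = c * pairing n A N" "pairing n N (c *f A) = c * pairing n N A"
  "pairing n 0 N = 0" "pairing n N 0 = 0"
  by (simp_all add: pairing_def pointwise algebra_simps sum.distrib sum_subtractf sum_distrib_left)

lemma outer_in_mats [simp, intro]: "x \<in> vecs n \<Longrightarrow> f \<in> vecs n \<Longrightarrow> outer x f \<in> mats n"
  by (auto simp: supp_on_def outer_def)

lemma app_outer [simp]: "app n (outer x f) v = dot n f v *f x"
  by (simp add: fun_eq_iff pointwise app_def outer_def dot_def sum_distrib_left mult_ac)

text \<open>Pairing with a rank-one matrix evaluates a form at a vector. All information on rank-one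
  elements of a space is extracted from its orthogonal through this identity.\<close>

lemma pairing_outer_left: "pairing n (outer x f) N = dot n f (app n N x)"
proof -
  have "pairing n (outer x f) N = (\<Sum>i<n. \<Sum>j<n. x i * f j * N (j, i))"
    by (simp add: pairing_def outer_def)
  also have "\<dots> = (\<Sum>j<n. \<Sum>i<n. x i * f j * N (j, i))" by (rule sum.swap)
  also have "\<dots> = dot n f (app n N x)"
    by (simp add: dot_def app_def sum_distrib_left mult_ac)
  finally show ?thesis .
qed

lemma pairing_commute: "pairing n A N = pairing n N A"
  unfolding pairing_def by (subst sum.swap) (simp add: mult.commute)

lemma idmat_in_mats [simp, intro]: "idmat n \<in> mats n"
  by (auto simp: supp_on_def idmat_def)

lemma app_idmat [simp]:
  assumes x: "x \<in> vecs n" shows "app n (idmat n) x = x"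
proof
  fix i
  have "app n (idmat n) x i = (\<Sum>j<n. if j = i then x i else 0)"
    unfolding app_def using x by (intro sum.cong) (auto simp: idmat_def supp_on_def)
  then show "app n (idmat n) x i = x i" using x by (auto simp: supp_on_def)
qed

lemma unit_fun_vecs [simp]: "i < n \<Longrightarrow> unit_fun i \<in> vecs n"
  by (rule unit_fun_supp_on) simp

lemma dot_unit_fun: "i < n \<Longrightarrow> dot n f (unit_fun i) = f i"
  by (simp add: dot_def unit_fun_def if_distrib sum.delta cong: if_cong)

lemma app_unit_fun: "j < n \<Longrightarrow> app n A (unit_fun j) = (\<lambda>i. A (i, j))"
  by (simp add: app_def unit_fun_def if_distrib sum.delta cong: if_cong)

lemma dot_nondegenerate:
  assumes "f \<in> vecs n" "\<And>v. v \<in> vecs n \<Longrightarrow> dot n f v = 0" shows "f = 0"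
proof
  fix i show "f i = 0 i"
    using assms(2)[of "unit_fun i"] assms(1)
    by (cases "i < n") (simp_all add: dot_unit_fun pointwise, simp add: supp_on_def)
qed

lemma mats_eqI:
  assumes "A \<in> mats n" "B \<in> mats n" "\<And>v. v \<in> vecs n \<Longrightarrow> app n A v = app n B v"
  shows "A = B"
proof
  fix p :: "nat \<times> nat" obtain i j where p: "p = (i, j)" by (cases p)
  show "A p = B p"
  proof (cases "j < n")
    case True
    then have "app n A (unit_fun j) = app n B (unit_fun j)" using assms(3) by simp
    then show ?thesis using True by (simp add: p app_unit_fun fun_eq_iff)
  next
    case False then show ?thesis using assms(1,2) by (auto simp: p supp_on_def)
  qed
qed

lemma pairing_eq_sum: 
  "pairing n A N = (\<Sum>j<n. dot n (unit_fun j) (app n N (app n A (unit_fun j))))"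
proof -
  have "dot n (unit_fun j) (app n N (app n A (unit_fun j))) = (\<Sum>i<n. N (j, i) * A (i, j))"
    if "j < n" for j
    using that by (simp add: dot_commute[of n "unit_fun j"] dot_unit_fun app_unit_fun) (simp add: app_def)
  then have "(\<Sum>j<n. dot n (unit_fun j) (app n N (app n A (unit_fun j)))) =
      (\<Sum>j<n. \<Sum>i<n. A (i, j) * N (j, i))"
    by (intro sum.cong) (auto simp: mult.commute)
  then show ?thesis unfolding pairing_def by (subst sum.swap) simp
qed

lemma pairing_eq_0:
  assumes "\<And>v. v \<in> vecs n \<Longrightarrow> app n N (app n A v) = 0"
  shows "pairing n A N = 0"
  by (simp add: pairing_eq_sum assms)

lemma separating_vec:
  assumes "fs.subspace X" "X \<subseteq> vecs n" "v \<in> vecs n" "v \<notin> X"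
  obtains f where "f \<in> vecs n" "\<And>x. x \<in> X \<Longrightarrow> dot n f x = 0" "dot n f v \<noteq> 0"
  using separating_functional[OF _ assms] by (auto simp: dot_def)

lemma separating_mat:
  assumes "fs.subspace X" "X \<subseteq> mats n" "A \<in> mats n" "A \<notin> X"
  obtains N where "N \<in> mats n" "\<And>B. B \<in> X \<Longrightarrow> pairing n B N = 0" "pairing n A N \<noteq> 0"
proof -
  obtain g where g: "g \<in> mats n" "\<And>x. x \<in> X \<Longrightarrow> (\<Sum>p\<in>{..<n}\<times>{..<n}. g p * x p) = 0"
    "(\<Sum>p\<in>{..<n}\<times>{..<n}. g p * A p) \<noteq> 0"
    using separating_functional[OF _ assms] by auto
  define N where "N = (\<lambda>(j, i). g (i, j))"
  have e: "pairing n B N = (\<Sum>p\<in>{..<n}\<times>{..<n}. g p * B p)" for B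
    by (simp add: pairing_def N_def sum.cartesian_product mult.commute case_prod_unfold)
  show thesis
  proof (rule that)
    show "N \<in> mats n" using g(1) by (auto simp: N_def supp_on_def)
  qed (use g in \<open>simp_all add: e\<close>)
qed

lemma nonzero_annihilator:
  fixes S :: "(nat \<Rightarrow> 'a::field) set"
  assumes "finite S" "card S < n" "S \<subseteq> vecs n"
  obtains f where "f \<in> vecs n" "f \<noteq> 0" "\<And>x. x \<in> S \<Longrightarrow> dot n f x = 0"
proof -
  have sub: "fs.span S \<subseteq> vecs n" by (rule fs.span_minimal[OF assms(3) subspace_supp_on])
  have "fs.span S \<noteq> vecs n"
  proof
    assume "fs.span S = vecs n"
    then have "card {..<n} \<le> card S"
      using fs.dim_le_card[of "vecs n" S] assms(1) dim_supp_on[of "{..<n}", where 'a = 'a] by simp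
    then show False using assms(2) by simp
  qed
  then obtain v where v: "v \<in> vecs n" "v \<notin> fs.span S" using sub by blast
  obtain f where f: "f \<in> vecs n" "\<And>x. x \<in> fs.span S \<Longrightarrow> dot n f x = 0" "dot n f v \<noteq> 0"
    by (rule separating_vec[OF fs.subspace_span sub v]) blast
  have "f \<noteq> 0" using f(3) by auto
  then show thesis using that f fs.span_base by blast
qed

section \<open>Conditions that hold almost everywhere on lines\<close>

text \<open>The subspace spanned by \<open>W x\<close> and \<open>T\<close> is the whole space, expressed by
  linear forms: only the zero form kills it.\<close>

definition full :: "nat \<Rightarrow> (nat \<times> nat \<Rightarrow> 'a::field) set \<Rightarrow> (nat \<Rightarrow> 'a) set \<Rightarrow> (nat \<Rightarrow> 'a) \<Rightarrow> bool"
  where "full n W T x \<longleftrightarrow>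
    (\<forall>f\<in>vecs n. (\<forall>B\<in>W. dot n f (app n B x) = 0) \<longrightarrow> (\<forall>t\<in>T. dot n f t = 0) \<longrightarrow> f = 0)"

lemma fullD:
  "full n W T x \<Longrightarrow> f \<in> vecs n \<Longrightarrow> (\<And>B. B \<in> W \<Longrightarrow> dot n f (app n B x) = 0) \<Longrightarrow>
    (\<And>t. t \<in> T \<Longrightarrow> dot n f t = 0) \<Longrightarrow> f = 0"
  by (auto simp: full_def)

lemma span_full:
  fixes S :: "(nat \<Rightarrow> 'a::field) set"
  assumes S: "S \<subseteq> vecs n" and f: "\<And>f. f \<in> vecs n \<Longrightarrow> (\<And>s. s \<in> S \<Longrightarrow> dot n f s = 0) \<Longrightarrow> f = 0"
  shows "fs.span S = vecs n"
proof (rule ccontr)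
  have sub: "fs.span S \<subseteq> vecs n" by (rule fs.span_minimal[OF S subspace_supp_on])
  assume "fs.span S \<noteq> vecs n"
  then obtain v where v: "v \<in> vecs n" "v \<notin> fs.span S" using sub by blast
  obtain f where f': "f \<in> vecs n" "\<And>x. x \<in> fs.span S \<Longrightarrow> dot n f x = 0" "dot n f v \<noteq> 0"
    by (rule separating_vec[OF fs.subspace_span sub v]) blast
  have "f = 0" using f f'(1,2) fs.span_base by blast
  then show False using f'(3) by simp
qed

lemma dot_span_0:
  assumes "\<And>s. s \<in> S \<Longrightarrow> dot n f s = 0" "v \<in> fs.span S" shows "dot n f v = 0"
proof -
  have "fs.span S \<subseteq> {v. dot n f v = 0}"
    by (rule fs.span_minimal) (use assms(1) in \<open>auto intro!: fs.subspaceI\<close>)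
  then show ?thesis using assms(2) by auto
qed

text \<open>Choose \<open>n\<close> independent vectors among \<open>W x \<union> T\<close>. Along the line their
  coordinates are polynomials of degree at most one, so their determinant is a polynomial in
  \<open>s\<close>, nonzero at \<open>s = 0\<close>; away from its finitely many roots these vectors
  still span.\<close>

lemma full_line_open:
  fixes x z :: "nat \<Rightarrow> 'a::field"
  assumes full: "full n W T x" and W: "W \<subseteq> mats n" and T: "T \<subseteq> vecs n"
    and x: "x \<in> vecs n" and z: "z \<in> vecs n"
  shows "finite {s. \<not> full n W T (x + s *f z)}"
proof -
  define G where "G = (\<lambda>B. (app n B x, app n B z)) ` W \<union> (\<lambda>t. (t, 0)) ` T"
  have "fs.span (fst ` G) = vecs n"
  proof (rule span_full)
    show "fst ` G \<subseteq> vecs n" using W T by (auto simp: G_def)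
    fix f :: "nat \<Rightarrow> 'a" assume f: "f \<in> vecs n" and k: "\<And>s. s \<in> fst ` G \<Longrightarrow> dot n f s = 0"
    have "dot n f (app n B x) = 0" if "B \<in> W" for B
      by (rule k) (use that in \<open>auto simp: G_def image_Un image_image\<close>)
    moreover have "dot n f t = 0" if "t \<in> T" for t
      by (rule k) (use that in \<open>auto simp: G_def image_Un image_image\<close>)
    ultimately show "f = 0" using fullD[OF full f] by blast
  qed
  obtain B where B: "B \<subseteq> fst ` G" "fs.independent B" "fst ` G \<subseteq> fs.span B"
    by (rule fs.basis_exists)
  have spB: "fs.span B = vecs n"
  proof
    show "fs.span B \<subseteq> vecs n" using B(1) \<open>fs.span (fst ` G) = vecs n\<close> fs.span_mono by blast
    show "vecs n \<subseteq> fs.span B"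
      using fs.span_minimal[OF B(3) fs.subspace_span] \<open>fs.span (fst ` G) = vecs n\<close> by simp
  qed
  have "fs.dim (vecs n :: (nat \<Rightarrow> 'a) set) = card B"
    using fs.dim_span_eq_card_independent[OF B(2)] spB by simp
  then have cB: "card B = n" using dim_supp_on[of "{..<n}", where 'a = 'a] by simp
  have "finite B"
    using finite_independent_supp_on[OF _ B(2), of "{..<n}"] fs.span_superset[of B] spB by auto
  then obtain g where g: "bij_betw g {..<n} B"
    using cB by (metis finite_same_card_bij finite_lessThan card_lessThan)
  have "\<exists>h. (g i, h) \<in> G" if "i < n" for i
    using B(1) g that by (force simp: bij_betw_def)
  then obtain h where h: "\<And>i. i < n \<Longrightarrow> (g i, h i) \<in> G" by metis
  \<comment> \<open>the values of \<open>det P\<close> are the determinants along the line\<close>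
  define P where "P = mat n n (\<lambda>(i, j). [:g i j, h i j:])"
  define D where "D s = mat n n (\<lambda>(i, j). g i j + s * h i j)" for s
  have P: "P \<in> carrier_mat n n" and D: "D s \<in> carrier_mat n n" for s by (auto simp: P_def D_def)
  have pD: "poly (det P) s = det (D s)" for s
  proof -
    interpret c: comm_ring_hom "\<lambda>p. poly p s" by unfold_locales auto
    have "map_mat (\<lambda>p. poly p s) P = D s" by (rule eq_matI) (auto simp: P_def D_def)
    then show ?thesis using c.hom_det[of P] by simp
  qed
  have "det (D 0) \<noteq> 0"
  proof
    assume "det (D 0) = 0"
    then obtain v where v: "v \<in> carrier_vec n" "v \<noteq> 0\<^sub>v n" "D 0 *\<^sub>v v = 0\<^sub>v n"
      using det_0_iff_vec_prod_zero_field[OF D] by blast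
    define f where "f = (\<lambda>i. if i < n then v $ i else 0)"
    have fv: "f \<in> vecs n" by (auto simp: f_def supp_on_def)
    have "dot n f (g i) = 0" if i: "i < n" for i
    proof -
      have "dot n f (g i) = (D 0 *\<^sub>v v) $ i"
        using i v(1) by (auto simp: D_def scalar_prod_def dot_def f_def atLeast0LessThan mult.commute intro!: sum.cong)
      then show ?thesis using v i by simp
    qed
    then have "dot n f b = 0" if "b \<in> B" for b using g that by (auto simp: bij_betw_def)
    then have "dot n f y = 0" if "y \<in> vecs n" for y using dot_span_0[of B n f y] spB that by auto
    then have "f = 0" using dot_nondegenerate[OF fv] by blast
    then have "v = 0\<^sub>v n" using v(1) by (intro eq_vecI) (auto simp: f_def fun_eq_iff pointwise split: if_splits)
    then show False using v(2) by simp
  qed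
  then have nz: "det P \<noteq> 0" using pD[of 0] by auto
  have "{s. \<not> full n W T (x + s *f z)} \<subseteq> {s. poly (det P) s = 0}"
  proof
    fix s assume "s \<in> {s. \<not> full n W T (x + s *f z)}"
    then obtain f where f: "f \<in> vecs n" "f \<noteq> 0" "\<And>B. B \<in> W \<Longrightarrow> dot n f (app n B (x + s *f z)) = 0"
        "\<And>t. t \<in> T \<Longrightarrow> dot n f t = 0"
      by (auto simp: full_def)
    have k: "dot n f (g i) + s * dot n f (h i) = 0" if "i < n" for i
      using h[OF that] f(3,4) by (auto simp: G_def)
    have "D s *\<^sub>v vec n f = 0\<^sub>v n"
    proof (rule eq_vecI)
      fix i assume "i < dim_vec (0\<^sub>v n :: 'a vec)" then have i: "i < n" by simp
      have "(D s *\<^sub>v vec n f) $ i = dot n f (g i) + s * dot n f (h i)"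
        using i by (simp add: D_def scalar_prod_def dot_def atLeast0LessThan sum_distrib_left
            sum.distrib algebra_simps)
      then show "(D s *\<^sub>v vec n f) $ i = 0\<^sub>v n $ i" using k i by simp
    qed (simp add: D_def)
    moreover have "vec n f \<noteq> 0\<^sub>v n"
    proof
      assume e: "vec n f = 0\<^sub>v n"
      have "f i = 0" for i
      proof (cases "i < n")
        case True then show ?thesis using arg_cong[OF e, of "\<lambda>v. v $ i"] by simp
      qed (use f(1) in \<open>auto simp: supp_on_def\<close>)
      then show False using f(2) by (auto simp: fun_eq_iff pointwise)
    qed
    ultimately have "det (D s) = 0"
      using det_0_iff_vec_prod_zero_field[OF D] by (metis vec_carrier)
    then show "s \<in> {s. poly (det P) s = 0}" using pD by simp
  qed
  then show ?thesis using poly_roots_finite[OF nz] finite_subset by blast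
qed

text \<open>A substitute for Zariski open sets. Two nonempty sets of this kind meet over an infinite
  field: it suffices to look at the line through a point of each.\<close>

definition line_open :: "nat \<Rightarrow> (nat \<Rightarrow> 'a::field) set \<Rightarrow> bool"
  where "line_open n S \<longleftrightarrow> S \<subseteq> vecs n \<and> (\<forall>x\<in>S. \<forall>z\<in>vecs n. finite {s. x + s *f z \<notin> S})"

lemma line_openD: "line_open n S \<Longrightarrow> x \<in> S \<Longrightarrow> z \<in> vecs n \<Longrightarrow> finite {s. x + s *f z \<notin> S}"
  by (auto simp: line_open_def)

lemma line_open_Int: "line_open n S \<Longrightarrow> line_open n T \<Longrightarrow> line_open n (S \<inter> T)"
proof -
  have "finite {s. x + s *f z \<notin> S \<inter> T}"
    if "finite {s. x + s *f z \<notin> S}" "finite {s. x + s *f z \<notin> T}" for x z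
    by (rule finite_subset[OF _ finite_UnI[OF that]]) auto
  then show "line_open n S \<Longrightarrow> line_open n T \<Longrightarrow> line_open n (S \<inter> T)"
    by (simp add: line_open_def) blast
qed

lemma line_open_full:
  assumes "W \<subseteq> mats n" "T \<subseteq> vecs n" shows "line_open n {x \<in> vecs n. full n W T x}"
proof -
  have "finite {s. x + s *f z \<notin> {x \<in> vecs n. full n W T x}}" if "full n W T x" "x \<in> vecs n" "z \<in> vecs n" for x z
    using full_line_open[OF that(1) assms that(2,3)] that(2,3) by simp
  then show ?thesis by (auto simp: line_open_def)
qed

lemma line_open_nonzero_dot: "line_open n {x \<in> vecs n. dot n f x \<noteq> 0}"
proof -
  have "finite {s. x + s *f z \<notin> {x \<in> vecs n. dot n f x \<noteq> 0}}"
    if x: "x \<in> vecs n" "dot n f x \<noteq> 0" and z: "z \<in> vecs n" for x z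
  proof -
    have "{s. x + s *f z \<notin> {x \<in> vecs n. dot n f x \<noteq> 0}} \<subseteq> {- dot n f x / dot n f z}"
    proof
      fix s assume "s \<in> {s. x + s *f z \<notin> {x \<in> vecs n. dot n f x \<noteq> 0}}"
      then have e: "dot n f x + s * dot n f z = 0" using x z by auto
      then have "dot n f z \<noteq> 0" using x by auto
      then show "s \<in> {- dot n f x / dot n f z}" using e by (simp add: field_simps eq_neg_iff_add_eq_0)
    qed
    then show ?thesis using finite_subset by blast
  qed
  then show ?thesis by (auto simp: line_open_def)
qed

lemma infinite_nonzero_avoid:
  assumes "infinite (UNIV :: 'a::field set)" "finite (F :: 'a set)"
  obtains s where "s \<notin> F" "s \<noteq> 0"
proof -
  have "infinite (UNIV - insert 0 F)" using assms by simp
  then obtain s where "s \<in> UNIV - insert 0 F" by (metis finite.emptyI ex_in_conv)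
  then show thesis using that by blast
qed

lemma line_open_meet:
  assumes inf: "infinite (UNIV :: 'a::field set)"
    and S: "line_open n S" "line_open n (T :: (nat \<Rightarrow> 'a) set)" and ne: "S \<noteq> {}" "T \<noteq> {}"
  shows "S \<inter> T \<noteq> {}"
proof -
  obtain x y where x: "x \<in> S" and y: "y \<in> T" using ne by blast
  have v: "x \<in> vecs n" "y \<in> vecs n" using x y S by (auto simp: line_open_def)
  have f: "finite {s. x + s *f (y - x) \<notin> S}" "finite {s. y + s *f (x - y) \<notin> T}"
    by (rule line_openD[OF S(1) x vecs_closed(3)[OF v(2,1)]],
        rule line_openD[OF S(2) y vecs_closed(3)[OF v(1,2)]])
  obtain s where s: "s \<notin> {s. x + s *f (y - x) \<notin> S} \<union> (\<lambda>s. 1 - s) ` {s. y + s *f (x - y) \<notin> T}"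
    by (rule infinite_nonzero_avoid[OF inf finite_UnI[OF f(1) finite_imageI[OF f(2)]]])
  have "y + (1 - s) *f (x - y) \<in> T"
  proof (rule ccontr)
    assume "y + (1 - s) *f (x - y) \<notin> T"
    then have "1 - (1 - s) \<in> (\<lambda>s. 1 - s) ` {s. y + s *f (x - y) \<notin> T}" by blast
    then show False using s by simp
  qed
  moreover have "y + (1 - s) *f (x - y) = x + s *f (y - x)"
    by (simp add: fun_eq_iff pointwise algebra_simps)
  ultimately show ?thesis using s by auto
qed

section \<open>Triangularizable operators and good vectors\<close>

text \<open>Triangularizability in a form that passes to all sections \<open>F / E\<close> by invariant subspaces,
  so that no change of basis is needed when working modulo a subspace.\<close>

definition flag_split :: "nat \<Rightarrow> (nat \<times> nat \<Rightarrow> 'a::field) \<Rightarrow> bool"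
  where "flag_split n A \<longleftrightarrow> (\<forall>E F. fs.subspace E \<longrightarrow> fs.subspace F \<longrightarrow> E \<subset> F \<longrightarrow> F \<subseteq> vecs n \<longrightarrow>
    app n A ` E \<subseteq> E \<longrightarrow> app n A ` F \<subseteq> F \<longrightarrow> (\<exists>v\<in>F - E. \<exists>c. app n A v - c *f v \<in> E))"

text \<open>Modulo \<open>Q\<close> the operator exchanges the lines of \<open>u\<close> and \<open>v\<close>, so
  its square acts on their plane as the scalar \<open>a * c\<close>. An eigenvalue \<open>l\<close> of
  \<open>A\<close> on this plane, which exists because \<open>A\<close> is split, satisfies
  \<open>l\<^sup>2 = a c\<close>.\<close>

lemma flag_split_plane:
  fixes A :: "nat \<times> nat \<Rightarrow> 'a::field"
  assumes A: "flag_split n A" and Q: "fs.subspace Q" "Q \<subseteq> vecs n" "\<And>q. q \<in> Q \<Longrightarrow> app n A q \<in> Q"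
    and u: "u \<in> vecs n" and v: "v \<in> vecs n"
    and ind: "\<And>a b. a *f u + b *f v \<in> Q \<Longrightarrow> a = 0 \<and> b = 0"
    and Au: "app n A u - a *f v \<in> Q" and Av: "app n A v - c *f u \<in> Q"
  shows "\<exists>l. l * l = a * c"
proof -
  define F where "F = {w. \<exists>q\<in>Q. \<exists>b d. w = q + b *f u + d *f v}"
  have F: "fs.subspace F"
  proof (rule fs.subspaceI)
    show "0 \<in> F" unfolding F_def using fs.subspace_0[OF Q(1)]
      by (auto intro!: bexI[of _ 0] exI[of _ 0])
    fix x y assume "x \<in> F" "y \<in> F"
    then obtain q b d q' b' d' where *: "q \<in> Q" "q' \<in> Q" "x = q + b *f u + d *f v" "y = q' + b' *f u + d' *f v"
      by (auto simp: F_def)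
    have "x + y = (q + q') + (b + b') *f u + (d + d') *f v"
      by (simp add: * fs.scale_left_distrib algebra_simps)
    then show "x + y \<in> F" unfolding F_def using fs.subspace_add[OF Q(1) *(1,2)] by blast
  next
    fix k x assume "x \<in> F"
    then obtain q b d where *: "q \<in> Q" "x = q + b *f u + d *f v" by (auto simp: F_def)
    have "k *f x = k *f q + (k * b) *f u + (k * d) *f v"
      by (simp add: * fs.scale_right_distrib)
    then show "k *f x \<in> F" unfolding F_def using fs.subspace_scale[OF Q(1) *(1)] by blast
  qed
  have FI: "q + b *f u + d *f v \<in> F" if "q \<in> Q" for q b d using that unfolding F_def by blast
  have uF: "u \<in> F" using FI[OF fs.subspace_0[OF Q(1)], of 1 0] by simp
  have vF: "v \<in> F" using FI[OF fs.subspace_0[OF Q(1)], of 0 1] by simp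
  have QF: "Q \<subseteq> F"
  proof
    fix q assume "q \<in> Q"
    then show "q \<in> F" unfolding F_def by (auto intro!: bexI[of _ q] exI[of _ 0])
  qed
  have "u \<notin> Q" using ind[of 1 0] by auto
  then have QF': "Q \<subset> F" using QF uF by blast
  have Fv: "F \<subseteq> vecs n" using Q(2) u v by (auto simp: F_def)
  have "app n A u \<in> F"
    using fs.subspace_add[OF F, of "app n A u - a *f v" "a *f v"] Au QF vF fs.subspace_scale[OF F vF] by auto
  moreover have "app n A v \<in> F"
    using fs.subspace_add[OF F, of "app n A v - c *f u" "c *f u"] Av QF uF fs.subspace_scale[OF F uF] by auto
  ultimately have "app n A w \<in> F" if "w \<in> F" for w
  proof -
    from that obtain q b d where *: "q \<in> Q" "w = q + b *f u + d *f v" by (auto simp: F_def)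
    have "app n A q \<in> F" using Q(3) * QF by blast
    then show ?thesis using \<open>app n A u \<in> F\<close> \<open>app n A v \<in> F\<close>
      by (simp add: *(2) fs.subspace_add[OF F] fs.subspace_scale[OF F])
  qed
  then obtain w l where w: "w \<in> F" "w \<notin> Q" "app n A w - l *f w \<in> Q"
    using A[unfolded flag_split_def, rule_format, OF Q(1) F QF' Fv] Q(3) by blast
  obtain q b d where *: "q \<in> Q" "w = q + b *f u + d *f v" using w(1) by (auto simp: F_def)
  \<comment> \<open>compare the coefficients of \<open>u\<close> and \<open>v\<close> in the eigenvector equation for \<open>w\<close> modulo \<open>Q\<close>\<close>
  have "(d * c - l * b) *f u + (b * a - l * d) *f v =
     (app n A w - l *f w) - (app n A q - l *f q) - b *f (app n A u - a *f v) - d *f (app n A v - c *f u)"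
    by (simp add: *(2) fun_eq_iff pointwise algebra_simps)
  also have "\<dots> \<in> Q"
    by (rule fs.subspace_diff[OF Q(1) fs.subspace_diff[OF Q(1) fs.subspace_diff[OF Q(1) w(3)]]])
      (intro fs.subspace_diff[OF Q(1)] fs.subspace_scale[OF Q(1)] Q(3) Au Av *(1))+
  finally have e: "d * c = l * b" "b * a = l * d" using ind by fastforce+
  have "b \<noteq> 0 \<or> d \<noteq> 0"
    using w(2) * by auto
  moreover have "l * l * b = a * c * b" using e by (metis mult.assoc mult.commute)
  moreover have "l * l * d = a * c * d" using e by (metis mult.assoc mult.commute)
  ultimately show ?thesis by (metis mult_cancel_right)
qed

text \<open>The row vector \<open>f A\<close>, that is, the linear form \<open>f\<close> composed with
  \<open>A\<close>.\<close>

definition tapp :: "nat \<Rightarrow> (nat \<times> nat \<Rightarrow> 'a::field) \<Rightarrow> (nat \<Rightarrow> 'a) \<Rightarrow> nat \<Rightarrow> 'a"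
  where "tapp n A f = (\<lambda>j. \<Sum>i<n. f i * A (i, j))"

lemma tapp_in_vecs [simp, intro]: "A \<in> mats n \<Longrightarrow> tapp n A f \<in> vecs n"
  by (auto simp: supp_on_def tapp_def)

lemma dot_tapp: "dot n (tapp n A f) v = dot n f (app n A v)"
proof -
  have "dot n (tapp n A f) v = (\<Sum>j<n. \<Sum>i<n. f i * (A (i, j) * v j))"
    by (simp add: dot_def tapp_def sum_distrib_right mult.assoc)
  also have "\<dots> = (\<Sum>i<n. \<Sum>j<n. f i * (A (i, j) * v j))" by (rule sum.swap)
  finally show ?thesis by (simp add: dot_def app_def sum_distrib_left)
qed

lemma app_span:
  assumes "\<And>s. s \<in> S \<Longrightarrow> app n A s \<in> X" "fs.subspace X" "v \<in> fs.span S" shows "app n A v \<in> X"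
proof -
  have "fs.span S \<subseteq> {v. app n A v \<in> X}"
    by (rule fs.span_minimal)
      (use assms(1,2) in \<open>auto intro!: fs.subspaceI simp: fs.subspace_0 fs.subspace_add fs.subspace_scale\<close>)
  then show ?thesis using assms(3) by auto
qed

lemma span_vecs: "S \<subseteq> vecs n \<Longrightarrow> fs.span S \<subseteq> vecs n"
  by (rule fs.span_minimal[OF _ subspace_supp_on])

text \<open>The witness \<open>nonsq\<close> of the non-surjectivity of squaring is fixed once and for all, since
  it serves as the product \<open>a * c\<close> in every use of the plane argument.\<close>

locale split_space =
  fixes n :: nat and V :: "(nat \<times> nat \<Rightarrow> 'a::field) set" and nonsq :: 'a
  assumes inf: "infinite (UNIV :: 'a set)"
    and nonsq: "l * l \<noteq> nonsq"
    and V_sub: "fs.subspace V" and V_mats: "V \<subseteq> mats n"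
    and V_split: "A \<in> V \<Longrightarrow> flag_split n A"
begin

definition perp where "perp = {N \<in> mats n. \<forall>A\<in>V. pairing n A N = 0}"

text \<open>Read modulo \<open>Q\<close>, these matrices are the orthogonal of the space of operators that the
  elements of \<open>V\<close> preserving the span of \<open>Q\<close> induce on the quotient by this
  span.\<close>

definition perp0 where "perp0 Q = {N \<in> perp. \<forall>q\<in>Q. app n N q = 0}"

text \<open>By duality this says that no element of \<open>V\<close> induces, modulo \<open>Q\<close>, a nonzero
  nilpotent operator \<open>x f\<close> of rank one: such an \<open>f\<close> would kill
  \<open>Q\<close>, \<open>x\<close> and all \<open>N x\<close>.\<close>

definition good where "good Q x \<longleftrightarrow> x \<in> vecs n \<and> full n (insert (idmat n) (perp0 Q)) Q x"

lemma perp_mats: "perp \<subseteq> mats n" and perp0_mats: "perp0 Q \<subseteq> mats n"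
  by (auto simp: perp_def perp0_def)

lemma perp_closed: "N \<in> perp \<Longrightarrow> N' \<in> perp \<Longrightarrow> N - N' \<in> perp" "N \<in> perp \<Longrightarrow> c *f N \<in> perp"
  by (auto simp: perp_def)

text \<open>The orthogonal of \<open>perp \<inter> R\<^sup>\<bottom>\<close> is \<open>V + R\<close>.\<close>

lemma mod_annihilator:
  assumes R: "fs.subspace R" "R \<subseteq> mats n" and A: "A \<in> mats n"
    and k: "\<And>N. N \<in> perp \<Longrightarrow> (\<And>C. C \<in> R \<Longrightarrow> pairing n C N = 0) \<Longrightarrow> pairing n A N = 0"
  obtains B where "B \<in> V" "A - B \<in> R"
proof -
  let ?X = "{B + C |B C. B \<in> V \<and> C \<in> R}"
  have "A \<in> ?X"
  proof (rule ccontr)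
    assume "A \<notin> ?X"
    have Xs: "fs.subspace ?X" by (rule fs.subspace_sums[OF V_sub R(1)])
    have Xm: "?X \<subseteq> mats n" using V_mats R(2) by blast
    obtain N where N: "N \<in> mats n" "\<And>B. B \<in> ?X \<Longrightarrow> pairing n B N = 0" "pairing n A N \<noteq> 0"
      by (rule separating_mat[OF Xs Xm A \<open>A \<notin> ?X\<close>]) blast
    have "pairing n B N = 0" if "B \<in> V" for B
    proof -
      have "B + 0 \<in> ?X" using that fs.subspace_0[OF R(1)] by blast
      from N(2)[OF this] show ?thesis by simp
    qed
    then have "N \<in> perp" using N(1) by (auto simp: perp_def)
    moreover have "pairing n C N = 0" if "C \<in> R" for C
    proof -
      have "0 + C \<in> ?X" using that fs.subspace_0[OF V_sub] by blast
      from N(2)[OF this] show ?thesis by simp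
    qed
    ultimately show False using k N(3) by blast
  qed
  then obtain B C where "B \<in> V" "C \<in> R" "A = B + C" by blast
  then show thesis using that[of B] by simp
qed

lemma double_annihilator:
  assumes A: "A \<in> mats n" and k: "\<And>N. N \<in> perp \<Longrightarrow> pairing n A N = 0"
  shows "A \<in> V"
proof -
  obtain B where "B \<in> V" "A - B \<in> {0}"
    by (rule mod_annihilator[of "{0}" A]) (use A k in auto)
  then show ?thesis by simp
qed

text \<open>Operators with range in the span of \<open>Q\<close> are orthogonal precisely to the matrices killing
  \<open>Q\<close>; so a rank-one matrix orthogonal to all of \<open>perp0 Q\<close> agrees with an
  element of \<open>V\<close> modulo \<open>Q\<close>.\<close>

lemma rank_one_mod:
  assumes Q: "Q \<subseteq> vecs n" and f: "f \<in> vecs n" "\<And>q. q \<in> Q \<Longrightarrow> dot n f q = 0"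
    and u: "u \<in> vecs n" and k: "\<And>N. N \<in> perp0 Q \<Longrightarrow> dot n f (app n N u) = 0"
  obtains A where "A \<in> V" "\<And>v. app n A v - dot n f v *f u \<in> fs.span Q"
proof -
  let ?R = "{C \<in> mats n. \<forall>v. app n C v \<in> fs.span Q}"
  have sub: "fs.subspace ?R"
    by (rule fs.subspaceI) (auto intro: fs.span_add fs.span_scale fs.span_zero)
  obtain A where A: "A \<in> V" "outer u f - A \<in> ?R"
  proof (rule mod_annihilator[OF sub _ outer_in_mats[OF u f(1)]])
    fix N assume N: "N \<in> perp" and NR: "\<And>C. C \<in> ?R \<Longrightarrow> pairing n C N = 0"
    have "app n N q = 0" if q: "q \<in> Q" for q
    proof (rule dot_nondegenerate)
      show "app n N q \<in> vecs n" using N perp_mats by blast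
      fix g :: "nat \<Rightarrow> 'a" assume g: "g \<in> vecs n"
      have "outer q g \<in> ?R" using q Q g by (auto intro: fs.span_scale fs.span_base)
      then have "pairing n (outer q g) N = 0" by (rule NR)
      then show "dot n (app n N q) g = 0" by (simp add: pairing_outer_left dot_commute)
    qed
    then show "pairing n (outer u f) N = 0" using k N by (simp add: pairing_outer_left perp0_def)
  qed auto
  have "app n A v - dot n f v *f u \<in> fs.span Q" for v
  proof -
    have "app n (outer u f - A) v \<in> fs.span Q" using A(2) by blast
    from fs.span_neg[OF this] show ?thesis by simp
  qed
  then show thesis using that A(1) by blast
qed

text \<open>Among all points \<open>x\<close> and all finite sets \<open>T\<close> completing \<open>perp0 Q
  x\<close>, \<open>x\<close> and \<open>Q\<close> to the whole space, take \<open>T\<close> of least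
  size; the claim is that it is empty. If \<open>y \<in> T\<close>, then \<open>T\<close> still works
  for some second point \<open>u = x + t y\<close> with \<open>t \<noteq> 0\<close>. Minimality
  provides forms \<open>g\<close> and \<open>f\<close>, belonging to \<open>x\<close> and
  \<open>u\<close>, that do not vanish at \<open>y\<close>, and these produce elements of
  \<open>V\<close> that modulo \<open>Q\<close> are the nilpotents \<open>x g\<close> and \<open>u
  f\<close>. As \<open>g u\<close> and \<open>f x\<close> are nonzero, a combination of both exchanges
  the lines of \<open>u\<close> and \<open>x\<close> with product \<open>nonsq\<close>.\<close>

lemma ex_good:
  assumes Q: "Q \<subseteq> vecs n"
  shows "\<exists>x. good Q x"
proof -
  let ?W = "insert (idmat n) (perp0 Q)"
  have W: "?W \<subseteq> mats n" using perp0_mats by auto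
  define P where "P k \<longleftrightarrow> (\<exists>x T. x \<in> vecs n \<and> finite T \<and> T \<subseteq> vecs n \<and> card T = k \<and> full n ?W (Q \<union> T) x)" for k
  have "\<exists>k. P k"
  proof -
    have "f = 0" if "f \<in> vecs n" "\<forall>t\<in>Q \<union> unit_fun ` {..<n}. dot n f t = 0" for f
    proof
      fix i show "f i = 0 i"
        using that(1) that(2)[rule_format, of "unit_fun i"]
        by (cases "i < n") (auto simp: dot_unit_fun pointwise, auto simp: supp_on_def)
    qed
    then have "full n ?W (Q \<union> unit_fun ` {..<n}) 0" by (auto simp: full_def)
    then have "P (card (unit_fun ` {..<n} :: (nat \<Rightarrow> 'a) set))"
      unfolding P_def by (intro exI[of _ 0] exI[of _ "unit_fun ` {..<n}"]) auto
    then show ?thesis by blast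
  qed
  define k where "k = (LEAST k. P k)"
  have "P k" unfolding k_def using \<open>\<exists>k. P k\<close> by (rule LeastI_ex)
  have least: "k \<le> j" if "P j" for j unfolding k_def using that by (rule Least_le)
  from \<open>P k\<close> obtain x T where x: "x \<in> vecs n" and T: "finite T" "T \<subseteq> vecs n" "card T = k"
    and fT: "full n ?W (Q \<union> T) x" unfolding P_def by blast
  show ?thesis
  proof (cases "T = {}")
    case True then show ?thesis using fT x by (auto simp: good_def)
  next
    case False
    then obtain y where y: "y \<in> T" by blast
    then have yv: "y \<in> vecs n" using T by blast
    define T' where "T' = T - {y}"
    have cT': "card T' < k" using T(1,3) y unfolding T'_def by (metis card_Diff1_less)
    have nf: "\<not> full n ?W (Q \<union> T') z" if "z \<in> vecs n" for z
    proof
      assume "full n ?W (Q \<union> T') z"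
      then have "P (card T')" unfolding P_def using that T by (intro exI[of _ z] exI[of _ T']) (auto simp: T'_def)
      then show False using least cT' by fastforce
    qed
    have killer: "\<exists>f\<in>vecs n. dot n f z = 0 \<and> (\<forall>N\<in>perp0 Q. dot n f (app n N z) = 0) \<and> (\<forall>q\<in>Q. dot n f q = 0) \<and> dot n f y \<noteq> 0"
      if z: "z \<in> vecs n" and fz: "full n ?W (Q \<union> T) z" for z
    proof -
      obtain f where f: "f \<in> vecs n" "f \<noteq> 0" "\<forall>B\<in>?W. dot n f (app n B z) = 0" "\<forall>t\<in>Q \<union> T'. dot n f t = 0"
        using nf[OF z] by (auto simp: full_def)
      have "dot n f y \<noteq> 0"
      proof
        assume "dot n f y = 0"
        then have "\<forall>t\<in>Q \<union> T. dot n f t = 0" using f(4) by (auto simp: T'_def)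
        then have "f = 0" using fullD[OF fz f(1)] f(3) by blast
        then show False using f(2) by simp
      qed
      then show ?thesis using f z by (intro bexI[of _ f]) auto
    qed
    have "finite {s. \<not> full n ?W (Q \<union> T) (x + s *f y)}"
      by (rule full_line_open[OF fT W _ x yv]) (use Q T in auto)
    then obtain t where t: "full n ?W (Q \<union> T) (x + t *f y)" "t \<noteq> 0"
      by (rule infinite_nonzero_avoid[OF inf]) auto
    define u where "u = x + t *f y"
    have u: "u \<in> vecs n" using x yv by (simp add: u_def)
    obtain g where g: "g \<in> vecs n" "dot n g x = 0" "\<forall>N\<in>perp0 Q. dot n g (app n N x) = 0"
        "\<forall>q\<in>Q. dot n g q = 0" "dot n g y \<noteq> 0"
      using killer[OF x fT] by blast
    obtain f where f: "f \<in> vecs n" "dot n f u = 0" "\<forall>N\<in>perp0 Q. dot n f (app n N u) = 0"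
        "\<forall>q\<in>Q. dot n f q = 0" "dot n f y \<noteq> 0"
      using killer[OF u] t(1) u_def by blast
    have gu: "dot n g u \<noteq> 0" using g t by (simp add: u_def)
    have fx: "dot n f x \<noteq> 0" using f(2,5) t by (auto simp: u_def)
    obtain A where A: "A \<in> V" "\<And>v. app n A v - dot n f v *f u \<in> fs.span Q"
      by (rule rank_one_mod[OF Q f(1) _ u]) (use f in auto)
    obtain B where B: "B \<in> V" "\<And>v. app n B v - dot n g v *f x \<in> fs.span Q"
      by (rule rank_one_mod[OF Q g(1) _ x]) (use g in auto)
    \<comment> \<open>with this factor the product of the two exchange factors of \<open>D\<close> is \<open>nonsq\<close>\<close>
    define c where "c = nonsq / (dot n g u * dot n f x)"
    define D where "D = A + c *f B"
    have "D \<in> V" unfolding D_def using A B V_sub by (intro fs.subspace_add fs.subspace_scale)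
    have Dm: "app n D v - dot n f v *f u - (c * dot n g v) *f x \<in> fs.span Q" for v
    proof -
      have "app n D v - dot n f v *f u - (c * dot n g v) *f x =
          (app n A v - dot n f v *f u) + c *f (app n B v - dot n g v *f x)"
        by (simp add: D_def fun_eq_iff pointwise algebra_simps)
      then show ?thesis using fs.span_add[OF A(2) fs.span_scale[OF B(2)]] by metis
    qed
    have "\<exists>l. l * l = (c * dot n g u) * dot n f x"
    proof (rule flag_split_plane[OF V_split[OF \<open>D \<in> V\<close>] fs.subspace_span span_vecs[OF Q] _ u x])
      fix q assume q: "q \<in> fs.span Q"
      have "dot n f q = 0" "dot n g q = 0" using dot_span_0[OF _ q] f(4) g(4) by blast+
      then show "app n D q \<in> fs.span Q" using Dm[of q] by simp
    next
      fix a b assume q: "a *f u + b *f x \<in> fs.span Q"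
      have "dot n f (a *f u + b *f x) = 0" "dot n g (a *f u + b *f x) = 0"
        using dot_span_0[OF _ q] f(4) g(4) by blast+
      then show "a = 0 \<and> b = 0" using f(2) g(2) gu fx by auto
    next
      show "app n D u - (c * dot n g u) *f x \<in> fs.span Q" using Dm[of u] f(2) by simp
      show "app n D x - dot n f x *f u \<in> fs.span Q" using Dm[of x] g(2) by simp
    qed
    moreover have "(c * dot n g u) * dot n f x = nonsq" using gu fx by (simp add: c_def)
    ultimately show ?thesis using nonsq by metis
  qed
qed

text \<open>Modulo \<open>Q\<close> the operator \<open>A\<close> is a rank-one nilpotent with range spanned by
  \<open>x\<close>, so it vanishes there by the choice of \<open>x\<close>.\<close>

lemma good_absorbs:
  assumes Q: "Q \<subseteq> vecs n" and x: "good Q x" and A: "A \<in> V"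
    and AQ: "\<And>q. q \<in> Q \<Longrightarrow> app n A q \<in> fs.span Q" and Ax: "app n A x \<in> fs.span Q"
    and im: "\<And>v. v \<in> vecs n \<Longrightarrow> app n A v \<in> fs.span (insert x Q)" and v: "v \<in> vecs n"
  shows "app n A v \<in> fs.span Q"
proof (cases "x \<in> fs.span Q")
  case True then show ?thesis using im[OF v] fs.span_redundant by blast
next
  case False
  have xv: "x \<in> vecs n" using x by (simp add: good_def)
  have Am: "A \<in> mats n" using A V_mats by blast
  obtain f0 where f0: "f0 \<in> vecs n" "\<And>q. q \<in> fs.span Q \<Longrightarrow> dot n f0 q = 0" "dot n f0 x \<noteq> 0"
    by (rule separating_vec[OF fs.subspace_span span_vecs[OF Q] xv False]) blast
  define f where "f = (1 / dot n f0 x) *f f0"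
  have f: "f \<in> vecs n" "\<And>q. q \<in> fs.span Q \<Longrightarrow> dot n f q = 0" "dot n f x = 1"
    using f0 by (auto simp: f_def)
  define g where "g = tapp n A f"
  have g: "g \<in> vecs n" "dot n g w = dot n f (app n A w)" for w
    using Am by (auto simp: g_def dot_tapp)
  have mod: "app n A w - dot n g w *f x \<in> fs.span Q" if "w \<in> vecs n" for w
  proof -
    from im[OF that] obtain k where k: "app n A w - k *f x \<in> fs.span Q"
      by (auto simp: fs.span_insert)
    from f(2)[OF k] have "dot n g w = k" using f(3) by (simp add: g)
    then show ?thesis using k by simp
  qed
  have "full n (insert (idmat n) (perp0 Q)) Q x" using x by (simp add: good_def)
  then have "g = 0"
  proof (rule fullD[OF _ g(1)])
    fix q assume "q \<in> Q" then show "dot n g q = 0" using AQ f(2) by (simp add: g)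
  next
    fix N assume "N \<in> insert (idmat n) (perp0 Q)"
    then show "dot n g (app n N x) = 0"
    proof
      assume "N = idmat n" then show ?thesis using Ax f(2) xv by (simp add: g)
    next
      assume N: "N \<in> perp0 Q"
      have "pairing n (A - outer x g) N = 0"
      proof (rule pairing_eq_0)
        fix w :: "nat \<Rightarrow> 'a" assume "w \<in> vecs n"
        then have "app n (A - outer x g) w \<in> fs.span Q" using mod by simp
        then have "app n N (app n (A - outer x g) w) \<in> {0}"
          by (rule app_span[rotated 2]) (use N in \<open>auto simp: perp0_def\<close>)
        then show "app n N (app n (A - outer x g) w) = 0" by simp
      qed
      moreover have "pairing n A N = 0" using A N by (simp add: perp0_def perp_def)
      ultimately show ?thesis by (simp add: pairing_outer_left)
    qed
  qed
  then show ?thesis using mod[OF v] by simp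
qed

end

section \<open>Strictly triangular complements\<close>

definition flag_basis :: "nat \<Rightarrow> (nat \<Rightarrow> nat \<Rightarrow> 'a::field) \<Rightarrow> bool"
  where "flag_basis n xs \<longleftrightarrow> (\<forall>i<n. xs i \<in> vecs n \<and> xs i \<notin> fs.span (xs ` {..<i}))"

text \<open>The matrices that become strictly upper triangular in the basis \<open>xs\<close>.\<close>

definition strict_upper :: "nat \<Rightarrow> (nat \<Rightarrow> nat \<Rightarrow> 'a::field) \<Rightarrow> (nat \<times> nat \<Rightarrow> 'a) set"
  where "strict_upper n xs = {A \<in> mats n. \<forall>j<n. app n A (xs j) \<in> fs.span (xs ` {..<j})}"

text \<open>Its cardinality is \<open>n (n + 1) / 2\<close>, the dimension of both the triangular and the symmetric
  matrices of size \<open>n\<close>.\<close>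

definition lower_pairs :: "nat \<Rightarrow> (nat \<times> nat) set"
  where "lower_pairs n = {(i, j). j \<le> i \<and> i < n}"

lemma finite_lower_pairs: "finite (lower_pairs n)"
  by (rule finite_subset[of _ "{..<n} \<times> {..<n}"]) (auto simp: lower_pairs_def)

lemma span_prefix_mono: "(i::nat) \<le> j \<Longrightarrow> fs.span (xs ` {..<i}) \<subseteq> fs.span (xs ` {..<j})"
  by (intro fs.span_mono image_mono) auto

lemma flag_basis_span:
  assumes "flag_basis n (xs :: nat \<Rightarrow> nat \<Rightarrow> 'a::field)"
  shows "fs.span (xs ` {..<n}) = vecs n"
proof -
  have "fs.independent (xs ` {..<k}) \<and> card (xs ` {..<k}) = k" if "k \<le> n" for k
    using that
  proof (induction k)
    case 0 then show ?case by (simp add: fs.independent_empty)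
  next
    case (Suc k)
    then have k: "xs k \<notin> fs.span (xs ` {..<k})" using assms by (auto simp: flag_basis_def)
    have "xs k \<notin> xs ` {..<k}" using k fs.span_base[of "xs k" "xs ` {..<k}"] by metis
    then show ?case using Suc fs.independent_insertI[OF k]
      by (simp add: lessThan_Suc)
  qed
  from this[of n] have *: "fs.independent (xs ` {..<n})" "card (xs ` {..<n}) = n" by auto
  have sub: "xs ` {..<n} \<subseteq> vecs n" using assms by (auto simp: flag_basis_def)
  have "fs.dim (fs.span (xs ` {..<n})) = n"
    using fs.dim_span_eq_card_independent[OF *(1)] *(2) by simp
  then show ?thesis
    using full_dim_supp_on[OF _ fs.subspace_span span_vecs[OF sub]] by simp
qed

lemma dim_inj_image:
  fixes f :: "('i \<Rightarrow> 'a::field) \<Rightarrow> ('j \<Rightarrow> 'a)"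
  assumes f: "Vector_Spaces.linear fscale fscale f" and X: "fs.subspace X" and inj: "inj_on f X"
  shows "fs.dim (f ` X) = fs.dim X"
proof -
  interpret f: Vector_Spaces.linear fscale fscale f by (rule f)
  obtain B where B: "B \<subseteq> X" "fs.independent B" "X \<subseteq> fs.span B" "card B = fs.dim X"
    by (rule fs.basis_exists)
  have sp: "fs.span B = X" using fs.span_minimal[OF B(1) X] B(3) by blast
  have ind: "fs.independent (f ` B)"
    using f.independent_injective_image[OF B(2)] inj sp by simp
  have "card (f ` B) = fs.dim (f ` X)"
    by (rule fs.basis_card_eq_dim[OF _ _ ind]) (use B(1) sp f.span_image[of B] in auto)
  moreover have "card (f ` B) = card B"
    by (rule card_image) (rule inj_on_subset[OF inj B(1)])
  ultimately show ?thesis using B(4) by simp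
qed

text \<open>The entries on and below the diagonal, read off in the basis \<open>xs\<close>, define a linear map
  with kernel \<open>strict_upper n xs\<close>. On \<open>X\<close> it is injective, hence surjective
  by dimension.\<close>

lemma strict_upper_complement:
  fixes X :: "(nat \<times> nat \<Rightarrow> 'a::field) set"
  assumes xs: "flag_basis n xs" and X: "fs.subspace X" "X \<subseteq> mats n"
    and triv: "X \<inter> strict_upper n xs \<subseteq> {0}" and d: "card (lower_pairs n) \<le> fs.dim X"
    and A: "A \<in> mats n"
  obtains B where "B \<in> X" "A - B \<in> strict_upper n xs"
proof -
  have "\<exists>f\<in>vecs n. (\<forall>v\<in>fs.span (xs ` {..<i}). dot n f v = 0) \<and> dot n f (xs i) \<noteq> 0" if i: "i < n" for i
  proof -
    have *: "xs i \<in> vecs n" "xs i \<notin> fs.span (xs ` {..<i})" using xs i by (auto simp: flag_basis_def)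
    have "xs ` {..<i} \<subseteq> vecs n" using xs i by (auto simp: flag_basis_def)
    from separating_vec[OF fs.subspace_span span_vecs[OF this] *] show ?thesis by metis
  qed
  then obtain f where f: "\<And>i. i < n \<Longrightarrow> f i \<in> vecs n"
      "\<And>i v. i < n \<Longrightarrow> v \<in> fs.span (xs ` {..<i}) \<Longrightarrow> dot n (f i) v = 0"
      "\<And>i. i < n \<Longrightarrow> dot n (f i) (xs i) \<noteq> 0" by metis
  have memb: "v \<in> fs.span (xs ` {..<j})"
    if v: "v \<in> vecs n" "\<And>i. j \<le> i \<Longrightarrow> i < n \<Longrightarrow> dot n (f i) v = 0" and j: "j \<le> n" for v j
    using j v(2)
  proof (induction rule: inc_induct)
    case base then show ?case using flag_basis_span[OF xs] v(1) by simp
  next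
    case (step k)
    then have "v \<in> fs.span (xs ` {..<Suc k})" by simp
    then obtain c where c: "v - c *f xs k \<in> fs.span (xs ` {..<k})"
      by (auto simp: lessThan_Suc fs.span_insert)
    have "dot n (f k) (v - c *f xs k) = 0" using f(2)[OF _ c] step by simp
    then have "c = 0" using f(3)[of k] step.hyps step.prems[of k] by simp
    then show ?case using c by simp
  qed
  define F :: "(nat \<times> nat \<Rightarrow> 'a) \<Rightarrow> nat \<times> nat \<Rightarrow> 'a"
    where "F A = (\<lambda>(i, j). if j \<le> i \<and> i < n then dot n (f i) (app n A (xs j)) else 0)" for A
  have lin: "Vector_Spaces.linear fscale fscale F"
    by unfold_locales (auto simp: F_def fun_eq_iff pointwise)
  have ker: "A \<in> strict_upper n xs" if "A \<in> mats n" "F A = 0" for A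
  proof -
    have "app n A (xs j) \<in> fs.span (xs ` {..<j})" if "j < n" for j
    proof (rule memb)
      fix i assume "j \<le> i" "i < n"
      then show "dot n (f i) (app n A (xs j)) = 0"
        using fun_cong[OF \<open>F A = 0\<close>, of "(i, j)"] by (simp add: F_def pointwise)
    qed (use that \<open>A \<in> mats n\<close> in auto)
    then show ?thesis using that by (simp add: strict_upper_def)
  qed
  interpret F: Vector_Spaces.linear fscale fscale F by (rule lin)
  have "inj_on F X"
  proof (rule inj_onI)
    fix A B assume *: "A \<in> X" "B \<in> X" "F A = F B"
    then have "A - B \<in> X" using X(1) fs.subspace_diff by blast
    moreover have "F (A - B) = 0" using * by (simp add: F.diff)
    ultimately have "A - B \<in> {0}" using ker X(2) triv by blast
    then show "A = B" by simp
  qed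
  then have "fs.dim (F ` X) = fs.dim X" by (rule dim_inj_image[OF lin X(1)])
  moreover have "F ` X \<subseteq> supp_on (lower_pairs n)"
    by (auto simp: F_def supp_on_def lower_pairs_def)
  ultimately have "F ` X = supp_on (lower_pairs n)"
    using full_dim_supp_on[OF finite_lower_pairs F.subspace_image[OF X(1)]] d by simp
  moreover have "F A \<in> supp_on (lower_pairs n)"
    by (auto simp: F_def supp_on_def lower_pairs_def)
  ultimately obtain B where B: "B \<in> X" "F A = F B" by (metis imageE)
  have "A - B \<in> strict_upper n xs"
    by (rule ker) (use A B X(2) in \<open>auto simp: F.diff\<close>)
  then show thesis using that B(1) by blast
qed

lemma flag_split_shift:
  assumes "flag_split n A" shows "flag_split n (A + c *f idmat n)"
  unfolding flag_split_def
proof (intro allI impI)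
  fix E F assume *: "fs.subspace E" "fs.subspace F" "E \<subset> F" "F \<subseteq> vecs n"
    "app n (A + c *f idmat n) ` E \<subseteq> E" "app n (A + c *f idmat n) ` F \<subseteq> F"
  have inv: "app n A ` G \<subseteq> G"
    if G: "fs.subspace G" "G \<subseteq> vecs n" "app n (A + c *f idmat n) ` G \<subseteq> G" for G
  proof
    fix w assume "w \<in> app n A ` G"
    then obtain v where v: "v \<in> G" "w = app n A v" by blast
    have "app n (A + c *f idmat n) v \<in> G" using G(3) v(1) by blast
    from fs.subspace_diff[OF G(1) this fs.subspace_scale[OF G(1) v(1), of c]]
    show "w \<in> G" using v G(2) by (simp add: subset_iff)
  qed
  have EF: "app n A ` E \<subseteq> E" "app n A ` F \<subseteq> F"
    using inv[OF *(1) _ *(5)] inv[OF *(2,4,6)] *(3,4) by auto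
  obtain v d where v: "v \<in> F - E" "app n A v - d *f v \<in> E"
    using assms[unfolded flag_split_def, rule_format, OF *(1-4) EF] by blast
  have vv: "v \<in> vecs n" using v(1) *(4) by blast
  have e: "app n (A + c *f idmat n) v - (d + c) *f v = app n A v - d *f v"
    using vv by (simp add: fs.scale_left_distrib)
  have "app n (A + c *f idmat n) v - (d + c) *f v \<in> E" unfolding e by (rule v(2))
  then show "\<exists>v\<in>F - E. \<exists>d. app n (A + c *f idmat n) v - d *f v \<in> E" using v(1) by blast
qed

context split_space begin

lemma good_notin_span:
  assumes Q: "finite Q" "card Q < n" "Q \<subseteq> vecs n" and x: "good Q x"
  shows "x \<notin> fs.span Q"
proof
  assume xQ: "x \<in> fs.span Q"
  obtain f where f: "f \<in> vecs n" "f \<noteq> 0" "\<And>q. q \<in> Q \<Longrightarrow> dot n f q = 0"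
    by (rule nonzero_annihilator[OF Q]) blast
  have xv: "x \<in> vecs n" using x by (simp add: good_def)
  have "app n N x = 0" if "N \<in> perp0 Q" for N
    using app_span[OF _ _ xQ, of n N "{0}"] that by (auto simp: perp0_def)
  then have "f = 0"
    using x f dot_span_0[OF f(3) xQ] xv unfolding good_def by (auto intro!: fullD[of n _ Q x f])
  then show False using f(2) by simp
qed

text \<open>Each vector is chosen good for the span of its predecessors.\<close>

lemma ex_good_flag:
  assumes x: "good {} x"
  obtains xs where "xs 0 = x" "\<And>i. i < n \<Longrightarrow> good (xs ` {..<i}) (xs i)" "flag_basis n xs"
proof -
  have "\<exists>xs. xs 0 = x \<and> (\<forall>i<k. good (xs ` {..<i}) (xs i))" for k :: nat
  proof (induction k)
    case 0 then show ?case by (intro exI[of _ "\<lambda>_. x"]) simp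
  next
    case (Suc k)
    then obtain xs where xs: "xs 0 = x" "\<And>i. i < k \<Longrightarrow> good (xs ` {..<i}) (xs i)" by blast
    show ?case
    proof (cases "k = 0")
      case True then show ?thesis using x by (intro exI[of _ "\<lambda>_. x"]) simp
    next
      case False
      have "xs ` {..<k} \<subseteq> vecs n" using xs(2) by (auto simp: good_def)
      then obtain y where y: "good (xs ` {..<k}) y" using ex_good by blast
      have im: "(xs(k := y)) ` {..<i} = xs ` {..<i}" if "i \<le> k" for i
        using that by (auto intro!: image_cong)
      have "good ((xs(k := y)) ` {..<i}) ((xs(k := y)) i)" if "i < Suc k" for i
        using that xs(2)[of i] y im[of i] by (cases "i = k") (auto simp del: fun_upd_image)
      then show ?thesis using xs(1) False by (intro exI[of _ "xs(k := y)"]) (auto simp del: fun_upd_image)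
    qed
  qed
  then obtain xs where xs: "xs 0 = x" "\<And>i. i < n \<Longrightarrow> good (xs ` {..<i}) (xs i)" by blast
  have "flag_basis n xs"
    unfolding flag_basis_def
  proof (intro allI impI conjI)
    fix i assume i: "i < n"
    show "xs i \<in> vecs n" using xs(2)[OF i] by (simp add: good_def)
    have "xs ` {..<i} \<subseteq> vecs n" using xs(2) i by (auto simp: good_def)
    moreover have "card (xs ` {..<i}) < n" using card_image_le[of "{..<i}" xs] i by simp
    ultimately show "xs i \<notin> fs.span (xs ` {..<i})" using good_notin_span xs(2)[OF i] by blast
  qed
  then show thesis using that xs by blast
qed

text \<open>Descending along the flag: once the range of \<open>A\<close> lies in the span of the first \<open>k +
  1\<close> vectors, goodness of the last of them pushes it into the span of the first
  \<open>k\<close>.\<close>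

lemma good_flag_absorbs:
  assumes xs: "\<And>i. i < n \<Longrightarrow> good (xs ` {..<i}) (xs i)" and fb: "flag_basis n xs" and A: "A \<in> V"
    and i: "i \<le> n" and lo: "\<And>j. j < i \<Longrightarrow> app n A (xs j) \<in> fs.span (xs ` {..<i})"
    and hi: "\<And>j. i \<le> j \<Longrightarrow> j < n \<Longrightarrow> app n A (xs j) \<in> fs.span (xs ` {..<j})"
    and v: "v \<in> vecs n"
  shows "app n A v \<in> fs.span (xs ` {..<i})"
  using i v
proof (induction arbitrary: v rule: inc_induct)
  case base then show ?case using flag_basis_span[OF fb] A V_mats by auto
next
  case (step k)
  have ik: "i \<le> k" "k < n" using step.hyps by auto
  show ?case
  proof (rule good_absorbs[OF _ xs[OF ik(2)] A _ hi[OF ik] _ step.prems])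
    show "xs ` {..<k} \<subseteq> vecs n" using fb ik by (auto simp: flag_basis_def)
    fix q assume "q \<in> xs ` {..<k}"
    then obtain j where j: "j < k" "q = xs j" by auto
    show "app n A q \<in> fs.span (xs ` {..<k})"
    proof (cases "j < i")
      case True then show ?thesis using lo[OF True] span_prefix_mono[OF ik(1)] j by blast
    next
      case False
      then show ?thesis using hi[of j] span_prefix_mono[of j k xs] j ik by auto
    qed
  next
    fix w :: "nat \<Rightarrow> 'a" assume "w \<in> vecs n"
    then show "app n A w \<in> fs.span (insert (xs k) (xs ` {..<k}))"
      using step.IH by (simp add: lessThan_Suc)
  qed
qed

lemma good_flag_trivial:
  assumes "\<And>i. i < n \<Longrightarrow> good (xs ` {..<i}) (xs i)" "flag_basis n xs"
  shows "V \<inter> strict_upper n xs \<subseteq> {0}"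
proof
  fix A assume A: "A \<in> V \<inter> strict_upper n xs"
  have "app n A v = 0" if "v \<in> vecs n" for v
    using good_flag_absorbs[OF assms, of A 0 v] A that by (auto simp: strict_upper_def)
  then have "A = 0" using A V_mats by (intro mats_eqI[of A n 0]) auto
  then show "A \<in> {0}" by simp
qed

end

locale large_split_space = split_space +
  assumes n_pos: "0 < n" and large: "card (lower_pairs n) \<le> fs.dim V"
begin

text \<open>The space \<open>V + F I\<close> is again split, so it also meets the strictly upper triangular matrices
  trivially in some basis. These are already complementary to \<open>V\<close>, which leaves no
  room for a larger space.\<close>

lemma idmat_in_V: "idmat n \<in> V"
proof -
  define V1 where "V1 = {A + c *f idmat n |A c. A \<in> V}"
  have V1I: "A + c *f idmat n \<in> V1" if "A \<in> V" for A c using that unfolding V1_def by blast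
  interpret V1: split_space n V1 nonsq
  proof
    show "fs.subspace V1"
    proof (rule fs.subspaceI)
      show "0 \<in> V1" using V1I[OF fs.subspace_0[OF V_sub], of 0] by simp
      fix x y assume "x \<in> V1" "y \<in> V1"
      then obtain A c B d where *: "A \<in> V" "B \<in> V" "x = A + c *f idmat n" "y = B + d *f idmat n"
        by (auto simp: V1_def)
      have "x + y = (A + B) + (c + d) *f idmat n" by (simp add: * fs.scale_left_distrib)
      then show "x + y \<in> V1" using V1I[OF fs.subspace_add[OF V_sub *(1,2)]] by simp
    next
      fix k x assume "x \<in> V1"
      then obtain A c where *: "A \<in> V" "x = A + c *f idmat n" by (auto simp: V1_def)
      have "k *f x = k *f A + (k * c) *f idmat n" by (simp add: * fs.scale_right_distrib)
      then show "k *f x \<in> V1" using V1I[OF fs.subspace_scale[OF V_sub *(1)]] by simp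
    qed
    show "V1 \<subseteq> mats n" using V_mats by (auto simp: V1_def)
    show "flag_split n A" if "A \<in> V1" for A
      using that V_split flag_split_shift by (auto simp: V1_def)
  qed (use inf nonsq in auto)
  have VV1: "V \<subseteq> V1"
  proof
    fix A assume "A \<in> V" then show "A \<in> V1" using V1I[of A 0] by simp
  qed
  have idV1: "idmat n \<in> V1" using V1I[OF fs.subspace_0[OF V_sub], of 1] by simp
  obtain x where x: "V1.good {} x" using V1.ex_good[of "{}"] by auto
  obtain xs where "xs 0 = x" and xs: "\<And>i. i < n \<Longrightarrow> V1.good (xs ` {..<i}) (xs i)" "flag_basis n xs"
    by (rule V1.ex_good_flag[OF x]) blast
  have triv: "V1 \<inter> strict_upper n xs \<subseteq> {0}" by (rule V1.good_flag_trivial[OF xs])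
  obtain B where B: "B \<in> V" "idmat n - B \<in> strict_upper n xs"
    by (rule strict_upper_complement[OF xs(2) V_sub V_mats _ large idmat_in_mats]) (use triv VV1 in auto)
  have "idmat n - B \<in> V1" using fs.subspace_diff[OF V1.V_sub idV1] B(1) VV1 by blast
  then have "idmat n - B = 0" using B(2) triv by blast
  then show ?thesis using B(1) by simp
qed

text \<open>Start a good flag with \<open>x\<close> and let \<open>g\<close> be a form with \<open>g x =
  1\<close>. The component in \<open>V\<close> of the projection \<open>x g\<close> fixes
  \<open>x\<close> and induces a strictly upper triangular operator modulo \<open>x\<close>. Goodness
  of the remaining basis vectors makes this induced operator vanish, so the component has rank one.\<close>

lemma good_idempotent:
  assumes x: "good {} x"
  obtains f where "f \<in> vecs n" "outer x f \<in> V" "dot n f x = 1"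
proof -
  note n = n_pos
  obtain xs where xs: "xs 0 = x" "\<And>i. i < n \<Longrightarrow> good (xs ` {..<i}) (xs i)" "flag_basis n xs"
    by (rule ex_good_flag[OF x]) blast
  have xv: "x \<in> vecs n" using x by (simp add: good_def)
  have x0: "x \<notin> {0}" using good_notin_span[of "{}" x] n x by simp
  obtain g0 where g0: "g0 \<in> vecs n" "dot n g0 x \<noteq> 0"
    using dot_nondegenerate[OF xv] x0 by (metis dot_commute singletonI)
  define g where "g = (1 / dot n g0 x) *f g0"
  have g: "g \<in> vecs n" "dot n g x = 1" using g0 by (auto simp: g_def)
  obtain A where A: "A \<in> V" "outer x g - A \<in> strict_upper n xs"
    by (rule strict_upper_complement[OF xs(3) V_sub V_mats good_flag_trivial[OF xs(2,3)] large outer_in_mats[OF xv g(1)]])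
  have Am: "A \<in> mats n" using A(1) V_mats by blast
  have Aj: "dot n g (xs j) *f x - app n A (xs j) \<in> fs.span (xs ` {..<j})" if "j < n" for j
    using A(2) that by (simp add: strict_upper_def)
  have Ax: "app n A x = x" using Aj[OF n] g(2) by (simp add: xs(1))
  have im: "app n A v \<in> fs.span (xs ` {..<1})" if "v \<in> vecs n" for v
  proof (rule good_flag_absorbs[OF xs(2,3) A(1) _ _ _ that])
    show "1 \<le> n" using n by simp
    show "app n A (xs j) \<in> fs.span (xs ` {..<1})" if "j < 1" for j
      using that Ax xs(1) by (auto intro: fs.span_base)
    fix j assume j: "1 \<le> j" "j < n"
    have "x \<in> fs.span (xs ` {..<j})" using xs(1) j by (intro fs.span_base) (auto intro!: image_eqI[of _ _ 0])
    from fs.span_diff[OF fs.span_scale[OF this, of "dot n g (xs j)"] Aj[OF j(2)]]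
    show "app n A (xs j) \<in> fs.span (xs ` {..<j})" by simp
  qed
  define f where "f = tapp n A g"
  have f: "f \<in> vecs n" "dot n f v = dot n g (app n A v)" for v
    using Am by (auto simp: f_def dot_tapp)
  have "A = outer x f"
  proof (rule mats_eqI[OF Am outer_in_mats[OF xv f(1)]])
    fix v :: "nat \<Rightarrow> 'a" assume "v \<in> vecs n"
    then obtain k where k: "app n A v = k *f x"
      using im[of v] xs(1) by (auto simp: lessThan_Suc fs.span_singleton)
    then show "app n A v = app n (outer x f) v" using g(2) by (simp add: f(2))
  qed
  moreover have "dot n f x = 1" using Ax g(2) by (simp add: f(2))
  ultimately show thesis using that f(1) A(1) by blast
qed

end

section \<open>The linear form attached to a good vector\<close>

lemma line_open_finite_meet:
  assumes inf: "infinite (UNIV :: 'a::field set)" and S: "line_open n (S :: (nat \<Rightarrow> 'a) set)" "S \<noteq> {}"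
    and T: "\<And>i. i < (k::nat) \<Longrightarrow> line_open n (T i) \<and> T i \<noteq> {}"
  shows "line_open n (S \<inter> (\<Inter>i<k. T i)) \<and> S \<inter> (\<Inter>i<k. T i) \<noteq> {}"
  using T
proof (induction k)
  case 0 then show ?case using S by simp
next
  case (Suc k)
  have *: "S \<inter> (\<Inter>i<Suc k. T i) = (S \<inter> (\<Inter>i<k. T i)) \<inter> T k"
    by (auto simp: lessThan_Suc)
  have 1: "line_open n (S \<inter> (\<Inter>i<k. T i))" "S \<inter> (\<Inter>i<k. T i) \<noteq> {}"
    using Suc by auto
  have 2: "line_open n (T k)" "T k \<noteq> {}" using Suc.prems[of k] by auto
  show ?case unfolding *
    using line_open_Int[OF 1(1) 2(1)] line_open_meet[OF inf 1(1) 2(1) 1(2) 2(2)] by simp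
qed

context large_split_space begin

definition good_vecs where "good_vecs = {x. good {} x}"

text \<open>The form that makes \<open>x (psi x)\<close> an idempotent of \<open>V\<close>; up to scalars it is
  the only form that kills \<open>perp x\<close>.\<close>

definition psi where "psi x = (SOME f. f \<in> vecs n \<and> outer x f \<in> V \<and> dot n f x = 1)"

lemma good_vecs_in_vecs: "x \<in> good_vecs \<Longrightarrow> x \<in> vecs n"
  by (simp add: good_vecs_def good_def)

lemma psi:
  assumes "x \<in> good_vecs" shows "psi x \<in> vecs n" "outer x (psi x) \<in> V" "dot n (psi x) x = 1"
proof -
  have "\<exists>f. f \<in> vecs n \<and> outer x f \<in> V \<and> dot n f x = 1"
    using good_idempotent[of x] assms unfolding good_vecs_def by blast
  from someI_ex[OF this] show "psi x \<in> vecs n" "outer x (psi x) \<in> V" "dot n (psi x) x = 1"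
    unfolding psi_def by auto
qed

lemma psi_kills: "x \<in> good_vecs \<Longrightarrow> N \<in> perp \<Longrightarrow> dot n (psi x) (app n N x) = 0"
  using psi(2)[of x] by (simp add: perp_def flip: pairing_outer_left)

lemma perp0_empty: "perp0 {} = perp"
  by (simp add: perp0_def)

lemma psi_unique:
  assumes x: "x \<in> good_vecs" and f: "f \<in> vecs n" "\<And>N. N \<in> perp \<Longrightarrow> dot n f (app n N x) = 0"
  shows "f = dot n f x *f psi x"
proof -
  let ?g = "f - dot n f x *f psi x"
  have "full n (insert (idmat n) perp) {} x" using x by (simp add: good_vecs_def good_def perp0_empty)
  then have "?g = 0"
  proof (rule fullD)
    show "?g \<in> vecs n" using f(1) psi(1)[OF x] by simp
    show "dot n ?g (app n B x) = 0" if "B \<in> insert (idmat n) perp" for B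
      using that f(2) psi_kills[OF x] psi(3)[OF x] good_vecs_in_vecs[OF x] by auto
  qed auto
  then show ?thesis by simp
qed

lemma line_open_good_vecs: "line_open n good_vecs"
proof -
  have "good_vecs = {x \<in> vecs n. full n (insert (idmat n) perp) {} x}"
    by (auto simp: good_vecs_def good_def perp0_empty)
  then show ?thesis using line_open_full[of "insert (idmat n) perp" n "{}"] perp_mats by simp
qed

lemma good_vecs_nonempty: "good_vecs \<noteq> {}"
  using ex_good[of "{}"] by (auto simp: good_vecs_def)

lemma line_open_psi_nonzero:
  assumes w: "w \<in> vecs n" shows "line_open n {x \<in> good_vecs. dot n (psi x) w \<noteq> 0}"
proof -
  have "full n perp {w} x \<longleftrightarrow> dot n (psi x) w \<noteq> 0" if x: "x \<in> good_vecs" for x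
  proof
    assume fx: "full n perp {w} x"
    show "dot n (psi x) w \<noteq> 0"
    proof
      assume "dot n (psi x) w = 0"
      then have "psi x = 0" using fullD[OF fx psi(1)[OF x]] psi_kills[OF x] by blast
      then show False using psi(3)[OF x] by simp
    qed
  next
    assume nz: "dot n (psi x) w \<noteq> 0"
    have "f = 0" if f: "f \<in> vecs n" "\<forall>N\<in>perp. dot n f (app n N x) = 0" "dot n f w = 0" for f
    proof -
      have e: "f = dot n f x *f psi x" using psi_unique[OF x f(1)] f(2) by blast
      have "dot n f w = dot n f x * dot n (psi x) w" by (subst e) simp
      then have "dot n f x = 0" using f(3) nz by simp
      then show ?thesis using e by simp
    qed
    then show "full n perp {w} x" by (simp add: full_def)
  qed
  then have "{x \<in> good_vecs. dot n (psi x) w \<noteq> 0} = good_vecs \<inter> {x \<in> vecs n. full n perp {w} x}"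
    using good_vecs_in_vecs by auto
  then show ?thesis
    using line_open_Int[OF line_open_good_vecs line_open_full[OF perp_mats, of "{w}"]] w by simp
qed

text \<open>If the value were nonzero, then \<open>psi (x + s z)\<close> would not vanish at \<open>N z\<close>
  either, for some good point \<open>x + s z\<close> with \<open>s \<noteq> 0\<close>. But this form
  kills \<open>N (x + s z) = s (N z)\<close>.\<close>

lemma psi_stable:
  assumes x: "x \<in> good_vecs" and N: "N \<in> perp" "app n N x = 0" and z: "z \<in> vecs n"
  shows "dot n (psi x) (app n N z) = 0"
proof (rule ccontr)
  let ?w = "app n N z"
  assume nz: "dot n (psi x) ?w \<noteq> 0"
  have w: "?w \<in> vecs n" using N(1) perp_mats by auto
  have "finite {s. x + s *f z \<notin> {x \<in> good_vecs. dot n (psi x) ?w \<noteq> 0}}"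
    by (rule line_openD[OF line_open_psi_nonzero[OF w] _ z]) (use x nz in simp)
  then obtain s where s: "x + s *f z \<in> good_vecs" "dot n (psi (x + s *f z)) ?w \<noteq> 0" "s \<noteq> 0"
    by (rule infinite_nonzero_avoid[OF inf]) auto
  have "dot n (psi (x + s *f z)) (app n N (x + s *f z)) = 0" by (rule psi_kills[OF s(1) N(1)])
  then show False using s N(2) by simp
qed

text \<open>This subspace measures how far the forms \<open>psi x\<close> are from spanning the dual space.\<close>

definition common_kernel where "common_kernel = {z \<in> vecs n. \<forall>x\<in>good_vecs. dot n (psi x) z = 0}"

lemma subspace_common_kernel: "fs.subspace common_kernel"
  by (rule fs.subspaceI) (auto simp: common_kernel_def)

text \<open>If all elements \<open>s\<close> of \<open>V\<close> that kill the common kernel satisfied \<open>h (s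
  w) = 0\<close>, then by duality the rank-one matrix \<open>w h\<close> would agree with some
  \<open>N \<in> perp\<close> up to a matrix with range in the common kernel. Evaluating \<open>psi x
  (N x) = 0\<close> gives \<open>h x * psi x w = 0\<close> for all good \<open>x\<close>, which is
  impossible for generic \<open>x\<close>.\<close>

lemma move_fixing_common_kernel:
  assumes w: "w \<in> vecs n" "w \<notin> common_kernel" and z: "z \<in> vecs n"
  obtains s where "s \<in> V" "\<And>y. y \<in> common_kernel \<Longrightarrow> app n s y = 0" "app n s w = z"
proof -
  define VS where "VS = {s \<in> V. \<forall>y\<in>common_kernel. app n s y = 0}"
  have VS: "fs.subspace VS"
    by (rule fs.subspaceI) (auto simp: VS_def fs.subspace_0[OF V_sub] fs.subspace_add[OF V_sub]
        fs.subspace_scale[OF V_sub])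
  let ?X = "(\<lambda>s. app n s w) ` VS"
  have X: "fs.subspace ?X"
  proof (rule fs.subspaceI)
    show "0 \<in> ?X" by (rule image_eqI[of _ _ 0]) (simp_all add: fs.subspace_0[OF VS])
    fix x y assume "x \<in> ?X" "y \<in> ?X"
    then obtain s t where "s \<in> VS" "t \<in> VS" "x = app n s w" "y = app n t w" by blast
    then show "x + y \<in> ?X" by (intro image_eqI[of _ _ "s + t"]) (simp_all add: fs.subspace_add[OF VS])
  next
    fix c x assume "x \<in> ?X"
    then obtain s where "s \<in> VS" "x = app n s w" by blast
    then show "c *f x \<in> ?X" by (intro image_eqI[of _ _ "c *f s"]) (simp_all add: fs.subspace_scale[OF VS])
  qed
  have Xv: "?X \<subseteq> vecs n" using V_mats by (auto simp: VS_def)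
  have "z \<in> ?X"
  proof (rule ccontr)
    assume "z \<notin> ?X"
    then obtain h where h: "h \<in> vecs n" "\<And>v. v \<in> ?X \<Longrightarrow> dot n h v = 0" "dot n h z \<noteq> 0"
      using separating_vec[OF X Xv z] by metis
    define R where "R = {C \<in> mats n. \<forall>v. app n C v \<in> common_kernel}"
    have R: "fs.subspace R"
      by (rule fs.subspaceI) (auto simp: R_def fs.subspace_0[OF subspace_common_kernel] fs.subspace_add[OF subspace_common_kernel]
        fs.subspace_scale[OF subspace_common_kernel])
    have perp: "fs.subspace perp" by (rule fs.subspaceI) (auto simp: perp_def)
    let ?UR = "{N + C |N C. N \<in> perp \<and> C \<in> R}"
    have UR: "fs.subspace ?UR" by (rule fs.subspace_sums[OF perp R])
    have URm: "?UR \<subseteq> mats n" using perp_mats by (auto simp: R_def)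
    have om: "outer w h \<in> mats n" using w h(1) by simp
    have "outer w h \<in> ?UR"
    proof (rule ccontr)
      assume no: "outer w h \<notin> ?UR"
      obtain A where A: "A \<in> mats n" "\<And>B. B \<in> ?UR \<Longrightarrow> pairing n B A = 0" "pairing n (outer w h) A \<noteq> 0"
        by (rule separating_mat[OF UR URm om no]) blast
      have "A \<in> V"
      proof (rule double_annihilator[OF A(1)])
        fix N assume "N \<in> perp"
        then have "N + 0 \<in> ?UR" using fs.subspace_0[OF R] by blast
        from A(2)[OF this] show "pairing n A N = 0" by (simp add: pairing_commute)
      qed
      moreover have "app n A y = 0" if y: "y \<in> common_kernel" for y
      proof (rule dot_nondegenerate)
        have yv: "y \<in> vecs n" using y by (simp add: common_kernel_def)
        show "app n A y \<in> vecs n" using A(1) by simp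
        fix g :: "nat \<Rightarrow> 'a" assume g: "g \<in> vecs n"
        have "outer y g \<in> R" using y yv g by (simp add: R_def fs.subspace_scale[OF subspace_common_kernel])
        then have "0 + outer y g \<in> ?UR" using fs.subspace_0[OF perp] by blast
        from A(2)[OF this] show "dot n (app n A y) g = 0"
          by (simp add: pairing_outer_left dot_commute)
      qed
      ultimately have "A \<in> VS" by (simp add: VS_def)
      then have "dot n h (app n A w) = 0" using h(2) by blast
      then show False using A(3) by (simp add: pairing_outer_left)
    qed
    then obtain N C where N: "N \<in> perp" "C \<in> R" "outer w h = N + C" by blast
    have "h \<noteq> 0" using h(3) by auto
    then obtain v where "v \<in> vecs n" "dot n h v \<noteq> 0" using dot_nondegenerate[OF h(1)] by blast
    then have H: "{x \<in> vecs n. dot n h x \<noteq> 0} \<noteq> {}" by blast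
    have P: "{x \<in> good_vecs. dot n (psi x) w \<noteq> 0} \<noteq> {}" using w by (auto simp: common_kernel_def)
    obtain x where x: "x \<in> good_vecs" "dot n (psi x) w \<noteq> 0" "dot n h x \<noteq> 0"
      using line_open_meet[OF inf line_open_psi_nonzero[OF w(1)] line_open_nonzero_dot P H] by blast
    have "app n N x + app n C x = dot n h x *f w" using N(3) by (metis app_linear(1) app_outer)
    then have "dot n (psi x) (app n N x) + dot n (psi x) (app n C x) = dot n h x * dot n (psi x) w"
      by (metis dot_linear(2,6))
    moreover have "dot n (psi x) (app n C x) = 0" using N(2) x(1) by (simp add: R_def common_kernel_def)
    ultimately show False using psi_kills[OF x(1) N(1)] x by simp
  qed
  then obtain s where "s \<in> VS" "app n s w = z" by blast
  then show thesis by (intro that[of s]) (auto simp: VS_def)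
qed

text \<open>Were \<open>w = A y\<close> outside the common kernel, then \<open>A\<close> could be corrected by an
  element of \<open>V\<close> that kills \<open>y\<close> so as to send \<open>w\<close> to
  \<open>nonsq\<close> times \<open>y\<close>.\<close>

lemma common_kernel_invariant:
  assumes A: "A \<in> V" and y: "y \<in> common_kernel" shows "app n A y \<in> common_kernel"
proof (rule ccontr)
  define w where "w = app n A y"
  assume "app n A y \<notin> common_kernel"
  then have wY: "w \<notin> common_kernel" by (simp add: w_def)
  have yv: "y \<in> vecs n" using y by (simp add: common_kernel_def)
  have wv: "w \<in> vecs n" using A V_mats by (auto simp: w_def)
  have "nonsq *f y - app n A w \<in> vecs n" using yv A V_mats by auto
  then obtain s where s: "s \<in> V" "\<And>y. y \<in> common_kernel \<Longrightarrow> app n s y = 0" "app n s w = nonsq *f y - app n A w"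
    by (rule move_fixing_common_kernel[OF wv wY]) blast
  define D where "D = A + s"
  have D: "D \<in> V" unfolding D_def by (rule fs.subspace_add[OF V_sub A s(1)])
  have Dy: "app n D y = w" using s(2)[OF y] by (simp add: D_def w_def)
  have Dw: "app n D w = nonsq *f y" using s(3) by (simp add: D_def)
  have "\<exists>l. l * l = 1 * nonsq"
  proof (rule flag_split_plane[OF V_split[OF D] _ _ _ yv wv])
    show "fs.subspace {0::nat \<Rightarrow> 'a}" by (rule fs.subspace_single_0)
    fix a b assume "a *f y + b *f w \<in> {0}"
    then have e: "b *f w = (- a) *f y" by (simp add: add_eq_0_iff)
    have b: "b = 0"
    proof (rule ccontr)
      assume "b \<noteq> 0"
      then have "w = (1 / b) *f (b *f w)" by simp
      also have "\<dots> \<in> common_kernel" unfolding e using y fs.subspace_scale[OF subspace_common_kernel] by blast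
      finally show False using wY by simp
    qed
    have "y \<noteq> 0" using wY fs.subspace_0[OF subspace_common_kernel] by (auto simp: w_def)
    then show "a = 0 \<and> b = 0" using e b by simp
  qed (auto simp: Dy Dw)
  then show False using nonsq by simp
qed

text \<open>Both \<open>psi x\<close> and \<open>psi z\<close> kill the vectors \<open>M z\<close> with \<open>M
  \<in> perp\<close>, \<open>M x = 0\<close>. Because \<open>z\<close> is good modulo
  \<open>x\<close>, these vectors together with \<open>x\<close> and \<open>z\<close> span the whole
  space, so they fill the intersection of the kernels of \<open>psi x\<close> and \<open>psi z\<close>
  if these forms are independent. Hence if \<open>psi x (N z) = 0\<close>, some \<open>M\<close> of
  this kind has \<open>M z = N z\<close>, and then \<open>psi z (N x) = psi z ((N - M) x) = 0\<close>.
  One functional of \<open>N\<close> thus vanishes wherever the other does. If \<open>psi x\<close>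
  and \<open>psi z\<close> are dependent, both functionals are zero.\<close>

lemma pair_relation:
  assumes x: "x \<in> good_vecs" and z: "z \<in> good_vecs" and xz: "good {x} z"
  obtains c where "c \<noteq> 0" "\<And>N. N \<in> perp \<Longrightarrow> dot n (psi x) (app n N z) = - c * dot n (psi z) (app n N x)"
proof (cases "\<exists>k. psi z = k *f psi x")
  case True
  then obtain k where k: "psi z = k *f psi x" by blast
  then have k0: "k \<noteq> 0" using psi(3)[OF z] by auto
  have "dot n (psi x) (app n N z) = - 1 * dot n (psi z) (app n N x)" if N: "N \<in> perp" for N
    using psi_kills[OF x N] psi_kills[OF z N] k0 by (simp add: k)
  then show thesis using that[of 1] by simp
next
  case False
  define f where "f N = dot n (psi x) (app n N z)" for N
  define g where "g N = dot n (psi z) (app n N x)" for N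
  let ?p = "dot n (psi z) x" and ?q = "dot n (psi x) z"
  note xv = good_vecs_in_vecs[OF x] and zv = good_vecs_in_vecs[OF z]
  have pq: "?p * ?q \<noteq> 1"
  proof
    assume pq: "?p * ?q = 1"
    let ?d = "psi z - ?p *f psi x"
    have "full n (insert (idmat n) (perp0 {x})) {x} z" using xz by (simp add: good_def)
    then have "?d = 0"
    proof (rule fullD)
      show "?d \<in> vecs n" using psi(1) x z by simp
      show "dot n ?d t = 0" if "t \<in> {x}" for t using that psi(3)[OF x] by simp
      fix B assume "B \<in> insert (idmat n) (perp0 {x})"
      then show "dot n ?d (app n B z) = 0"
      proof
        assume "B = idmat n" then show ?thesis using pq psi(3)[OF z] zv by simp
      next
        assume B: "B \<in> perp0 {x}"
        then have "B \<in> perp" "app n B x = 0" by (auto simp: perp0_def)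
        then show ?thesis using psi_kills[OF z] psi_stable[OF x _ _ zv] by simp
      qed
    qed
    then have "psi z = ?p *f psi x" by simp
    then show False using False by blast
  qed
  have key: "g N = 0" if N: "N \<in> perp" and fN: "f N = 0" for N
  proof -
    let ?X = "(\<lambda>N. app n N z) ` perp0 {x}"
    have perp0: "fs.subspace (perp0 {x})" by (rule fs.subspaceI) (auto simp: perp0_def perp_def)
    have X: "fs.subspace ?X"
    proof (rule fs.subspaceI)
      show "0 \<in> ?X" by (rule image_eqI[of _ _ 0]) (simp_all add: fs.subspace_0[OF perp0])
      fix a b assume "a \<in> ?X" "b \<in> ?X"
      then obtain s t where "s \<in> perp0 {x}" "t \<in> perp0 {x}" "a = app n s z" "b = app n t z" by blast
      then show "a + b \<in> ?X" by (intro image_eqI[of _ _ "s + t"]) (simp_all add: fs.subspace_add[OF perp0])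
    next
      fix c a assume "a \<in> ?X"
      then obtain s where "s \<in> perp0 {x}" "a = app n s z" by blast
      then show "c *f a \<in> ?X" by (intro image_eqI[of _ _ "c *f s"]) (simp_all add: fs.subspace_scale[OF perp0])
    qed
    have Xv: "?X \<subseteq> vecs n" using perp0_mats by auto
    have Nz: "app n N z \<in> vecs n" using N perp_mats by auto
    have "app n N z \<in> ?X"
    proof (rule ccontr)
      assume no: "app n N z \<notin> ?X"
      obtain h where h: "h \<in> vecs n" "\<And>v. v \<in> ?X \<Longrightarrow> dot n h v = 0" "dot n h (app n N z) \<noteq> 0"
        by (rule separating_vec[OF X Xv Nz no]) blast
      \<comment> \<open>Cramer's rule: \<open>?d\<close> below kills \<open>x\<close> and \<open>z\<close> as well, so \<open>h\<close> is a combination of the two forms\<close>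
      define c where "c = (dot n h z - ?q * dot n h x) / (1 - ?p * ?q)"
      define b where "b = dot n h x - c * ?p"
      let ?d = "h - b *f psi x - c *f psi z"
      have c: "c * (1 - ?p * ?q) = dot n h z - ?q * dot n h x" using pq by (simp add: c_def)
      have "full n (insert (idmat n) (perp0 {x})) {x} z" using xz by (simp add: good_def)
      then have "?d = 0"
      proof (rule fullD)
        show "?d \<in> vecs n" using psi(1) x z h(1) by simp
        show "dot n ?d t = 0" if "t \<in> {x}" for t using that psi(3)[OF x] by (simp add: b_def)
        fix B assume "B \<in> insert (idmat n) (perp0 {x})"
        then show "dot n ?d (app n B z) = 0"
        proof
          assume B: "B = idmat n"
          have "dot n h z - b * ?q - c = 0" using c by (simp add: b_def algebra_simps)
          then show ?thesis using B zv psi(3)[OF z] by simp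
        next
          assume B: "B \<in> perp0 {x}"
          then have "B \<in> perp" "app n B x = 0" by (auto simp: perp0_def)
          then show ?thesis using psi_kills[OF z] psi_stable[OF x _ _ zv] h(2) B by simp
        qed
      qed
      then have "dot n ?d (app n N z) = 0" by simp
      then have "dot n h (app n N z) = 0" using fN psi_kills[OF z N] by (simp add: f_def)
      then show False using h(3) by simp
    qed
    then obtain M where M: "M \<in> perp0 {x}" "app n N z = app n M z" by blast
    then have "N - M \<in> perp" "app n (N - M) z = 0" using N by (auto simp: perp0_def perp_closed)
    from psi_stable[OF z this xv] show ?thesis using M(1) by (simp add: g_def perp0_def)
  qed
  have "\<exists>N\<in>perp. f N \<noteq> 0"
  proof (rule ccontr)
    assume "\<not> (\<exists>N\<in>perp. f N \<noteq> 0)"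
    then have e: "psi x = ?q *f psi z"
      using psi_unique[OF z psi(1)[OF x]] by (simp add: f_def)
    then have q: "?q \<noteq> 0" using psi(3)[OF x] by auto
    have "(1 / ?q) *f psi x = (1 / ?q) *f (?q *f psi z)" using e by metis
    then have "psi z = (1 / ?q) *f psi x" using q by simp
    then show False using False by blast
  qed
  then obtain N1 where N1: "N1 \<in> perp" "f N1 \<noteq> 0" by blast
  have fg: "g N = g N1 / f N1 * f N" if N: "N \<in> perp" for N
  proof -
    let ?M = "N - (f N / f N1) *f N1"
    have "?M \<in> perp" using N N1 perp_closed by blast
    moreover have "f ?M = 0" using N1 by (simp add: f_def)
    ultimately have "g ?M = 0" by (rule key)
    then show ?thesis by (simp add: g_def)
  qed
  have "g N1 \<noteq> 0"
  proof
    assume "g N1 = 0"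
    then have "\<And>N. N \<in> perp \<Longrightarrow> dot n (psi z) (app n N x) = 0" using fg by (simp add: g_def)
    then have "psi z = ?p *f psi x" by (rule psi_unique[OF x psi(1)[OF z]])
    then show False using False by blast
  qed
  show thesis
  proof (rule that)
    show "- (f N1 / g N1) \<noteq> 0" using N1 \<open>g N1 \<noteq> 0\<close> by simp
    fix N assume "N \<in> perp"
    then show "dot n (psi x) (app n N z) = - (- (f N1 / g N1)) * dot n (psi z) (app n N x)"
      using fg[of N] N1(2) \<open>g N1 \<noteq> 0\<close> by (simp flip: f_def g_def)
  qed
qed

end

section \<open>Gluing the forms into a bilinear form\<close>

lemma flag_basis_lincomb:
  fixes xs :: "nat \<Rightarrow> nat \<Rightarrow> 'a::field"
  assumes xs: "flag_basis n xs" and s: "(\<Sum>i<n. c i *f xs i) = 0" and i: "i < n"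
  shows "c i = 0"
proof -
  have "\<forall>i<k. c i = 0" if "k \<le> n" "(\<Sum>i<k. c i *f xs i) = 0" for k
    using that
  proof (induction k)
    case (Suc k)
    have e: "(\<Sum>i<k. c i *f xs i) = - (c k *f xs k)"
      using Suc.prems(2) by (simp add: add_eq_0_iff2)
    have ck: "c k = 0"
    proof (rule ccontr)
      assume c: "c k \<noteq> 0"
      have "(- 1 / c k) *f (\<Sum>i<k. c i *f xs i) \<in> fs.span (xs ` {..<k})"
        by (intro fs.span_scale fs.span_sum fs.span_base) auto
      moreover have "(- 1 / c k) *f (\<Sum>i<k. c i *f xs i) = xs k" unfolding e using c by simp
      ultimately show False using xs Suc.prems(1) by (auto simp: flag_basis_def)
    qed
    then have "(\<Sum>i<k. c i *f xs i) = 0" unfolding e by simp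
    from Suc.IH[OF Suc_leD[OF Suc.prems(1)] this] ck show ?case by (simp add: less_Suc_eq)
  qed simp
  then show ?thesis using s i by blast
qed

lemma flag_basis_three:
  fixes xs :: "nat \<Rightarrow> nat \<Rightarrow> 'a::field"
  assumes xs: "flag_basis n xs" and ijk: "i < n" "j < n" "k < n" "i \<noteq> j" "i \<noteq> k" "j \<noteq> k"
    and s: "a *f xs i + b *f xs j + c *f xs k = 0"
  shows "a = 0 \<and> b = 0 \<and> c = 0"
proof -
  define d where "d l = (if l = i then a else if l = j then b else if l = k then c else 0)" for l
  have "(\<Sum>l<n. d l *f xs l) = (\<Sum>l\<in>{i, j, k}. d l *f xs l)"
    using ijk by (intro sum.mono_neutral_right) (auto simp: d_def)
  also have "\<dots> = 0" using s ijk by (simp add: d_def add.assoc)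
  finally show ?thesis
    using flag_basis_lincomb[OF xs, of d i] flag_basis_lincomb[OF xs, of d j]
      flag_basis_lincomb[OF xs, of d k] ijk by (simp add: d_def)
qed

lemma span_prefix_sum:
  assumes "v \<in> fs.span (xs ` {..<k::nat})"
  obtains c where "v = (\<Sum>i<k. c i *f xs i)"
proof -
  have "\<exists>c. v = (\<Sum>i<k. c i *f xs i)"
    using assms
  proof (induction k arbitrary: v)
    case 0 then show ?case by simp
  next
    case (Suc k)
    then obtain a where "v - a *f xs k \<in> fs.span (xs ` {..<k})"
      by (auto simp: lessThan_Suc fs.span_insert)
    then obtain c where c: "v - a *f xs k = (\<Sum>i<k. c i *f xs i)" using Suc.IH by blast
    have "(\<Sum>i<k. (c(k := a)) i *f xs i) = (\<Sum>i<k. c i *f xs i)" by (intro sum.cong) auto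
    then have "v = (\<Sum>i<Suc k. (c(k := a)) i *f xs i)" by (simp flip: c)
    then show ?case by blast
  qed
  then show thesis using that by blast
qed

text \<open>The diagonal is required to vanish separately, so that characteristic two is covered.\<close>

lemma sum_alternating:
  fixes a :: "nat \<Rightarrow> nat \<Rightarrow> 'a::field"
  assumes "\<And>i. i < n \<Longrightarrow> a i i = 0" "\<And>i j. i < n \<Longrightarrow> j < n \<Longrightarrow> i \<noteq> j \<Longrightarrow> a i j = - a j i"
  shows "(\<Sum>i<n. \<Sum>j<n. a i j) = 0"
  using assms
proof (induction n)
  case 0
  show ?case by simp
next
  case (Suc n)
  have "(\<Sum>i<n. a i n) = (\<Sum>i<n. - a n i)"
  proof (rule sum.cong)
    fix i assume "i \<in> {..<n}"
    then show "a i n = - a n i" by (intro Suc.prems(2)) auto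
  qed simp
  then have "(\<Sum>i<n. a i n) = - (\<Sum>j<n. a n j)" by (simp add: sum_negf)
  moreover have "(\<Sum>i<n. \<Sum>j<n. a i j) = 0" by (rule Suc.IH) (auto intro: Suc.prems)
  moreover have "a n n = 0" by (rule Suc.prems(1)) simp
  ultimately show ?case by (simp add: sum.distrib)
qed

locale irreducible_space = large_split_space +
  assumes irreducible: "fs.subspace E \<Longrightarrow> E \<subseteq> vecs n \<Longrightarrow> (\<And>A v. A \<in> V \<Longrightarrow> v \<in> E \<Longrightarrow> app n A v \<in> E) \<Longrightarrow>
    E = {0} \<or> E = vecs n"
begin

text \<open>By irreducibility the common kernel is trivial, since it does not contain good vectors.\<close>

lemma psi_separates:
  assumes w: "w \<in> vecs n" "w \<noteq> 0" shows "{x \<in> good_vecs. dot n (psi x) w \<noteq> 0} \<noteq> {}"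
proof -
  obtain x where x: "x \<in> good_vecs" using good_vecs_nonempty by blast
  have "x \<notin> common_kernel"
  proof
    assume "x \<in> common_kernel"
    then have "dot n (psi x) x = 0" using x by (simp add: common_kernel_def)
    then show False using psi(3)[OF x] by simp
  qed
  then have "common_kernel \<noteq> vecs n" using good_vecs_in_vecs[OF x] by blast
  moreover have "common_kernel = {0} \<or> common_kernel = vecs n"
    by (rule irreducible[OF subspace_common_kernel _ common_kernel_invariant]) (auto simp: common_kernel_def)
  ultimately have "w \<notin> common_kernel" using w by blast
  then show ?thesis using w by (auto simp: common_kernel_def)
qed

text \<open>At every step finitely many nonempty line-open conditions have to be met: being good, also modulo each
  previous vector, lying off the hyperplane of a form \<open>h\<close> that kills the previous
  vectors, and having a form that does not vanish at a vector \<open>w\<close> killed by the previous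
  forms.\<close>

lemma ex_generic_basis:
  obtains e where "\<And>k. k < n \<Longrightarrow> e k \<in> good_vecs" "\<And>i k. k < n \<Longrightarrow> i < k \<Longrightarrow> good {e i} (e k)"
    "flag_basis n e" "flag_basis n (\<lambda>k. psi (e k))"
proof -
  define ok where "ok e k \<longleftrightarrow> e k \<in> good_vecs \<and> (\<forall>i<k. good {e i} (e k)) \<and> e k \<notin> fs.span (e ` {..<k}) \<and>
    psi (e k) \<notin> fs.span ((\<lambda>i. psi (e i)) ` {..<k})" for e and k :: nat
  have "\<exists>e. \<forall>k<m. ok e k" if "m \<le> n" for m
    using that
  proof (induction m)
    case (Suc m)
    then obtain e where e: "\<And>k. k < m \<Longrightarrow> ok e k" by auto
    have eG: "e i \<in> good_vecs" if "i < m" for i using e[OF that] by (simp add: ok_def)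
    have c: "card (f ` {..<m}) < n" for f :: "nat \<Rightarrow> nat \<Rightarrow> 'a"
      using card_image_le[of "{..<m}" f] Suc.prems by simp
    obtain w where w: "w \<in> vecs n" "w \<noteq> 0" "\<And>x. x \<in> (\<lambda>i. psi (e i)) ` {..<m} \<Longrightarrow> dot n w x = 0"
      by (rule nonzero_annihilator[OF _ c, of "\<lambda>i. psi (e i)"]) (use psi(1) eG in auto)
    obtain h where h: "h \<in> vecs n" "h \<noteq> 0" "\<And>x. x \<in> e ` {..<m} \<Longrightarrow> dot n h x = 0"
      by (rule nonzero_annihilator[OF _ c, of e]) (use good_vecs_in_vecs eG in auto)
    have H: "{x \<in> vecs n. dot n h x \<noteq> 0} \<noteq> {}" using dot_nondegenerate[OF h(1)] h(2) by blast
    have T: "line_open n {z. good {e i} z} \<and> {z. good {e i} z} \<noteq> {}" if "i < m" for i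
    proof
      have ei: "e i \<in> vecs n" using eG[OF that] good_vecs_in_vecs by blast
      show "{z. good {e i} z} \<noteq> {}" using ex_good[of "{e i}"] ei by auto
      have "{z. good {e i} z} = {z \<in> vecs n. full n (insert (idmat n) (perp0 {e i})) {e i} z}"
        by (auto simp: good_def)
      then show "line_open n {z. good {e i} z}"
        using line_open_full[of "insert (idmat n) (perp0 {e i})" n "{e i}"] perp0_mats ei by simp
    qed
    let ?P = "{x \<in> good_vecs. dot n (psi x) w \<noteq> 0} \<inter> {x \<in> vecs n. dot n h x \<noteq> 0}"
    have P1: "line_open n ?P" by (rule line_open_Int[OF line_open_psi_nonzero[OF w(1)] line_open_nonzero_dot])
    have P2: "?P \<noteq> {}"
      by (rule line_open_meet[OF inf line_open_psi_nonzero[OF w(1)] line_open_nonzero_dot psi_separates[OF w(1,2)] H])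
    obtain x where x: "x \<in> ?P" "\<And>i. i < m \<Longrightarrow> good {e i} x"
      using line_open_finite_meet[OF inf P1 P2, of m "\<lambda>i. {z. good {e i} z}"] T by auto
    have x1: "x \<notin> fs.span (e ` {..<m})"
    proof
      assume "x \<in> fs.span (e ` {..<m})"
      from dot_span_0[OF h(3) this] show False using x by auto
    qed
    have x2: "psi x \<notin> fs.span ((\<lambda>i. psi (e i)) ` {..<m})"
    proof
      assume "psi x \<in> fs.span ((\<lambda>i. psi (e i)) ` {..<m})"
      from dot_span_0[OF w(3) this] show False using x by (auto simp: dot_commute)
    qed
    define e' where "e' = e(m := x)"
    have e'1: "e' i = e i" if "i < m" for i using that by (simp add: e'_def)
    have e'2: "e' m = x" by (simp add: e'_def)
    have im: "e' ` {..<k} = e ` {..<k}" "(\<lambda>i. psi (e' i)) ` {..<k} = (\<lambda>i. psi (e i)) ` {..<k}" if "k \<le> m" for k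
      using that e'1 by (auto intro!: image_cong)
    have "ok e' k" if "k < Suc m" for k
    proof (cases "k = m")
      case True
      show ?thesis unfolding ok_def True im[OF order_refl] e'2 using x x1 x2 e'1 by auto
    next
      case False
      then have k: "k < m" using that by simp
      show ?thesis using e[OF k] unfolding ok_def im[OF less_imp_le[OF k]] e'1[OF k] using e'1 k by auto
    qed
    then show ?case by blast
  qed simp
  then obtain e where e: "\<forall>k<n. ok e k" by blast
  show thesis
  proof (rule that)
    show "e k \<in> good_vecs" if "k < n" for k using e that by (simp add: ok_def)
    show "good {e i} (e k)" if "k < n" "i < k" for i k using e that by (simp add: ok_def)
    show "flag_basis n e" using e good_vecs_in_vecs by (simp add: flag_basis_def ok_def)
    show "flag_basis n (\<lambda>k. psi (e k))" using e psi(1) by (simp add: flag_basis_def ok_def)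
  qed
qed

text \<open>The forms of a generic basis are rescaled so that the constants relating them to the last vector
  \<open>e b\<close> all equal \<open>1\<close>. The constant \<open>t\<close> of any other pair
  \<open>k\<close>, \<open>j\<close> is then computed from a vector \<open>x = e b + s e j\<close>:
  its form is proportional to \<open>f b + s f j\<close>, and the relation between \<open>e k\<close>
  and \<open>x\<close> yields a linear form killing \<open>perp (e k)\<close>. It must be a multiple
  of \<open>f k\<close>, and independence of the three forms forces \<open>t = 1\<close>.\<close>

lemma ex_skew_basis:
  obtains e f where "flag_basis n e" "\<And>c. (\<Sum>i<n. c i *f f i) = 0 \<Longrightarrow> \<forall>i<n. c i = 0"
    "\<And>i. i < n \<Longrightarrow> f i \<in> vecs n"
    "\<And>i N. i < n \<Longrightarrow> N \<in> perp \<Longrightarrow> dot n (f i) (app n N (e i)) = 0"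
    "\<And>i j N. i < n \<Longrightarrow> j < n \<Longrightarrow> i \<noteq> j \<Longrightarrow> N \<in> perp \<Longrightarrow>
      dot n (f i) (app n N (e j)) = - dot n (f j) (app n N (e i))"
proof -
  obtain e where e: "\<And>k. k < n \<Longrightarrow> e k \<in> good_vecs" "\<And>i k. k < n \<Longrightarrow> i < k \<Longrightarrow> good {e i} (e k)"
    "flag_basis n e" "flag_basis n (\<lambda>k. psi (e k))"
    by (rule ex_generic_basis) blast
  have rel: "\<exists>c. c \<noteq> 0 \<and> (\<forall>N\<in>perp. dot n (psi (e i)) (app n N (e j)) = - c * dot n (psi (e j)) (app n N (e i)))"
    if ij: "i < n" "j < n" "i \<noteq> j" for i j
  proof (cases "i < j")
    case True
    show ?thesis by (rule pair_relation[OF e(1)[OF ij(1)] e(1)[OF ij(2)] e(2)[OF ij(2) True]]) blast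
  next
    case False
    then have "j < i" using ij by simp
    then obtain c where c: "c \<noteq> 0"
        "\<And>N. N \<in> perp \<Longrightarrow> dot n (psi (e j)) (app n N (e i)) = - c * dot n (psi (e i)) (app n N (e j))"
      by (rule pair_relation[OF e(1)[OF ij(2)] e(1)[OF ij(1)] e(2)[OF ij(1)]]) blast
    have "dot n (psi (e i)) (app n N (e j)) = - (1 / c) * dot n (psi (e j)) (app n N (e i))" if "N \<in> perp" for N
      using c(1) c(2)[OF that] by simp
    then show ?thesis using c(1) by (intro exI[of _ "1 / c"]) simp
  qed
  \<comment> \<open>the last vector is good modulo every other one, and so are almost all \<open>e b + s e j\<close>\<close>
  define b where "b = n - 1"
  have b: "b < n" using n_pos by (simp add: b_def)
  have "\<exists>c. c \<noteq> 0 \<and> (k \<noteq> b \<longrightarrow> (\<forall>N\<in>perp. dot n (psi (e k)) (app n N (e b)) = - c * dot n (psi (e b)) (app n N (e k))))"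
    if "k < n" for k
    using rel[OF that b] by (cases "k = b") (auto intro!: exI[of _ 1])
  then obtain c where c: "\<And>k. k < n \<Longrightarrow> c k \<noteq> 0"
    "\<And>k N. k < n \<Longrightarrow> k \<noteq> b \<Longrightarrow> N \<in> perp \<Longrightarrow>
      dot n (psi (e k)) (app n N (e b)) = - c k * dot n (psi (e b)) (app n N (e k))"
    by metis
  define f where "f k = (if k = b then psi (e b) else (1 / c k) *f psi (e k))" for k
  define d where "d k = (if k = b then 1 else 1 / c k)" for k
  have fd: "f k = d k *f psi (e k)" for k by (simp add: f_def d_def)
  have d0: "d k \<noteq> 0" if "k < n" for k using c(1)[OF that] by (simp add: d_def)
  have fv: "f k \<in> vecs n" if "k < n" for k unfolding fd using psi(1)[OF e(1)[OF that]] by simp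
  have fb: "dot n (f k) (app n N (e b)) = - dot n (f b) (app n N (e k))" if "k < n" "k \<noteq> b" "N \<in> perp" for k N
    using c(2)[OF that] c(1)[OF that(1)] that(2) by (simp add: f_def)
  have fk: "dot n (f k) (app n N (e k)) = 0" if "k < n" "N \<in> perp" for k N
    using psi_kills[OF e(1)[OF that(1)] that(2)] by (simp add: fd)
  have fjk: "dot n (f k) (app n N (e j)) = - dot n (f j) (app n N (e k))"
    if jk: "j < n" "k < n" "j \<noteq> b" "k \<noteq> b" "j \<noteq> k" and N: "N \<in> perp" for j k N
  proof -
    obtain t0 where t0: "t0 \<noteq> 0"
      "\<And>N. N \<in> perp \<Longrightarrow> dot n (psi (e k)) (app n N (e j)) = - t0 * dot n (psi (e j)) (app n N (e k))"
      using rel[OF jk(2,1)] jk(5) by blast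
    define t where "t = d k * t0 / d j"
    have t: "dot n (f k) (app n N (e j)) = - t * dot n (f j) (app n N (e k))" if "N \<in> perp" for N
      using t0(2)[OF that] d0[OF jk(1)] by (simp add: t_def fd)
    have ev: "e j \<in> vecs n" "e k \<in> vecs n" "e b \<in> vecs n" using e(1) good_vecs_in_vecs jk b by auto
    have kb: "k < b" using jk by (simp add: b_def)
    have "finite {s. e b + s *f e j \<notin> good_vecs}" by (rule line_openD[OF line_open_good_vecs e(1)[OF b] ev(1)])
    moreover have "finite {s. \<not> good {e k} (e b + s *f e j)}"
    proof -
      have "full n (insert (idmat n) (perp0 {e k})) {e k} (e b)" using e(2)[OF b kb] by (simp add: good_def)
      from full_line_open[OF this _ _ ev(3,1)]
      have "finite {s. \<not> full n (insert (idmat n) (perp0 {e k})) {e k} (e b + s *f e j)}"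
        using perp0_mats ev(2) by simp
      then show ?thesis using ev by (simp add: good_def)
    qed
    ultimately have "finite ({s. e b + s *f e j \<notin> good_vecs} \<union> {s. \<not> good {e k} (e b + s *f e j)})" by simp
    then obtain s where s: "e b + s *f e j \<in> good_vecs" "good {e k} (e b + s *f e j)" "s \<noteq> 0"
      by (rule infinite_nonzero_avoid[OF inf]) auto
    define x where "x = e b + s *f e j"
    define h where "h = f b + s *f f j"
    have x: "x \<in> good_vecs" "good {e k} x" using s by (simp_all add: x_def)
    have hx: "dot n h (app n N x) = 0" if "N \<in> perp" for N
      using fk[OF b that] fk[OF jk(1) that] fb[OF jk(1,3) that] by (simp add: h_def x_def algebra_simps)
    have hv: "h \<in> vecs n" using fv b jk by (simp add: h_def)
    have h: "h = dot n h x *f psi x" by (rule psi_unique[OF x(1) hv hx])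
    have indep: "p = 0 \<and> q = 0 \<and> r = 0" if "p *f f b + q *f f j + r *f f k = 0" for p q r
    proof -
      have "(p * d b) *f psi (e b) + (q * d j) *f psi (e j) + (r * d k) *f psi (e k) = 0"
        using that by (simp add: fd)
      from flag_basis_three[OF e(4) b jk(1,2) _ _ jk(5) this] jk b d0 show ?thesis by auto
    qed
    have "h \<noteq> 0" using indep[of 1 s 0] by (auto simp: h_def)
    then have hx0: "dot n h x \<noteq> 0" using h by auto
    obtain r0 where r0: "r0 \<noteq> 0"
      "\<And>N. N \<in> perp \<Longrightarrow> dot n (psi (e k)) (app n N x) = - r0 * dot n (psi x) (app n N (e k))"
      by (rule pair_relation[OF e(1)[OF jk(2)] x]) blast
    define r where "r = d k * r0 / dot n h x"
    have r: "dot n (f k) (app n N x) = - r * dot n h (app n N (e k))" if "N \<in> perp" for N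
    proof -
      have "dot n h (app n N (e k)) = dot n h x * dot n (psi x) (app n N (e k))" by (subst h) simp
      then show ?thesis using r0(2)[OF that] hx0 by (simp add: r_def fd)
    qed
    let ?g = "(r - 1) *f f b + (s * (r - t)) *f f j"
    have "dot n ?g (app n N (e k)) = 0" if "N \<in> perp" for N
      using r[OF that] t[OF that] fb[OF jk(2,4) that] by (simp add: x_def h_def algebra_simps)
    moreover have "?g \<in> vecs n" using fv b jk by simp
    ultimately have g: "?g = dot n ?g (e k) *f psi (e k)" by (intro psi_unique[OF e(1)[OF jk(2)]])
    define m where "m = dot n ?g (e k)"
    have "?g + (- m / d k) *f f k = ?g - m *f psi (e k)"
      using d0[OF jk(2)] by (simp add: fd[of k] fs.scale_minus_left)
    also have "\<dots> = 0" using g unfolding m_def by (metis diff_self)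
    finally have "r - 1 = 0 \<and> s * (r - t) = 0" using indep by blast
    then have "t = 1" using s(3) by auto
    then show ?thesis using t[OF N] by simp
  qed
  show thesis
  proof (rule that[of e f])
    show "flag_basis n e" by (rule e(3))
    show "\<forall>i<n. a i = 0" if "(\<Sum>i<n. a i *f f i) = 0" for a
    proof -
      have "(\<Sum>i<n. (a i * d i) *f psi (e i)) = 0" using that by (simp add: fd)
      from flag_basis_lincomb[OF e(4) this] d0 show ?thesis by auto
    qed
    show "dot n (f i) (app n N (e j)) = - dot n (f j) (app n N (e i))"
      if "i < n" "j < n" "i \<noteq> j" "N \<in> perp" for i j N
    proof -
      consider "j = b" | "i = b" | "i \<noteq> b" "j \<noteq> b" by blast
      then show ?thesis
      proof cases
        case 1 then show ?thesis using fb[of i N] that by simp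
      next
        case 2 then show ?thesis using fb[of j N] that by simp
      next
        case 3 then show ?thesis using fjk[of j i N] that by simp
      qed
    qed
  qed (use fv fk in auto)
qed

end

section \<open>Spaces of selfadjoint operators\<close>

definition matmul :: "nat \<Rightarrow> (nat \<times> nat \<Rightarrow> 'a::field) \<Rightarrow> (nat \<times> nat \<Rightarrow> 'a) \<Rightarrow> nat \<times> nat \<Rightarrow> 'a"
  where "matmul n A B = (\<lambda>(i, j). \<Sum>k<n. A (i, k) * B (k, j))"

lemma matmul_in_mats: "A \<in> mats n \<Longrightarrow> B \<in> mats n \<Longrightarrow> matmul n A B \<in> mats n"
  by (auto simp: supp_on_def matmul_def)

lemma app_matmul: "app n (matmul n A B) x = app n A (app n B x)"
proof
  fix i
  have "app n (matmul n A B) x i = (\<Sum>j<n. \<Sum>k<n. A (i, k) * (B (k, j) * x j))"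
    by (simp add: app_def matmul_def sum_distrib_right mult.assoc)
  also have "\<dots> = (\<Sum>k<n. \<Sum>j<n. A (i, k) * (B (k, j) * x j))" by (rule sum.swap)
  finally show "app n (matmul n A B) x i = app n A (app n B x) i"
    by (simp add: app_def sum_distrib_left)
qed

lemma pairing_matmul: "pairing n (matmul n A B) N = pairing n A (matmul n B N)"
proof -
  have "pairing n (matmul n A B) N = (\<Sum>i<n. \<Sum>j<n. \<Sum>k<n. A (i, k) * (B (k, j) * N (j, i)))"
    by (simp add: pairing_def matmul_def sum_distrib_right mult.assoc)
  also have "\<dots> = (\<Sum>i<n. \<Sum>k<n. \<Sum>j<n. A (i, k) * (B (k, j) * N (j, i)))"
    by (intro sum.cong refl sum.swap)
  finally show ?thesis by (simp add: pairing_def matmul_def sum_distrib_left)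
qed

lemma dot_app_sym:
  assumes "\<And>i j. S (i, j) = S (j, i)"
  shows "dot n x (app n S y) = dot n (app n S x) y"
proof -
  have "tapp n S x = app n S x"
    using assms by (simp add: tapp_def app_def fun_eq_iff mult.commute)
  then show ?thesis by (simp flip: dot_tapp)
qed

text \<open>The matrix \<open>G\<close> represents the bilinear form \<open>(x, y) \<mapsto> x G y\<close>; its
  symmetry is a consequence.\<close>

locale form_space = large_split_space +
  fixes G
  assumes G_mats: "G \<in> mats n"
    and G_nondeg: "x \<in> vecs n \<Longrightarrow> tapp n G x = 0 \<Longrightarrow> x = 0"
    and G_alt: "x \<in> vecs n \<Longrightarrow> N \<in> perp \<Longrightarrow> dot n (tapp n G x) (app n N x) = 0"
begin

text \<open>For \<open>N \<in> perp\<close> the matrix \<open>G N\<close> is alternating, hence orthogonal to all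
  symmetric matrices.\<close>

lemma sym_matmul_in_V:
  assumes S: "S \<in> mats n" "\<And>i j. S (i, j) = S (j, i)"
  shows "matmul n S G \<in> V"
proof (rule double_annihilator[OF matmul_in_mats[OF S(1) G_mats]])
  fix N assume N: "N \<in> perp"
  define K where "K = matmul n G N"
  have K: "dot n x (app n K x) = 0" if "x \<in> vecs n" for x
    using G_alt[OF that N] by (simp add: K_def app_matmul dot_tapp)
  have entry: "dot n (unit_fun i) (app n K (unit_fun j)) = K (i, j)" if "i < n" "j < n" for i j
    using that by (simp add: dot_commute[of n "unit_fun i"] dot_unit_fun app_unit_fun)
  have Kd: "K (i, i) = 0" if "i < n" for i
    using K[of "unit_fun i"] entry[OF that that] that by simp
  have Ks: "K (j, i) = - K (i, j)" if "i < n" "j < n" for i j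
  proof -
    have "K (i, j) + K (j, i) = 0"
      using K[of "unit_fun i + unit_fun j"] that by (simp add: entry Kd add.commute)
    then show ?thesis by (simp add: eq_neg_iff_add_eq_0 add.commute)
  qed
  have "(\<Sum>i<n. \<Sum>j<n. S (i, j) * K (j, i)) = 0"
  proof (rule sum_alternating)
    show "S (i, i) * K (i, i) = 0" if "i < n" for i using Kd[OF that] by simp
    show "S (i, j) * K (j, i) = - (S (j, i) * K (i, j))" if "i < n" "j < n" for i j
      using Ks[OF that] S(2)[of i j] by simp
  qed
  then have "pairing n S K = 0" by (simp add: pairing_def)
  then show "pairing n (matmul n S G) N = 0" by (simp add: pairing_matmul K_def)
qed

text \<open>The products \<open>S G\<close> form a subspace of \<open>V\<close> of dimension \<open>n (n + 1) /
  2\<close>, so they are also a complement of the strictly upper triangular matrices in a good basis.\<close>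

lemma V_sym_matmul:
  assumes A: "A \<in> V"
  obtains S where "S \<in> mats n" "\<And>i j. S (i, j) = S (j, i)" "A = matmul n S G"
proof -
  define L where "L = (supp_on (lower_pairs n) :: (nat \<times> nat \<Rightarrow> 'a) set)"
  \<comment> \<open>the symmetric matrix with prescribed entries on and below the diagonal\<close>
  define sy :: "(nat \<times> nat \<Rightarrow> 'a) \<Rightarrow> nat \<times> nat \<Rightarrow> 'a" where "sy f = (\<lambda>(i, j). f (max i j, min i j))" for f
  define F where "F f = matmul n (sy f) G" for f
  have lin: "Vector_Spaces.linear fscale fscale F"
    by unfold_locales
      (auto simp: F_def sy_def matmul_def fun_eq_iff pointwise algebra_simps sum.distrib sum_distrib_left)
  interpret F: Vector_Spaces.linear fscale fscale F by (rule lin)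
  have sym: "sy f (i, j) = sy f (j, i)" for f i j by (simp add: sy_def max.commute min.commute)
  have sm: "sy f \<in> mats n" if "f \<in> L" for f
    using that by (auto simp: L_def sy_def supp_on_def lower_pairs_def)
  have sL: "fs.subspace L" unfolding L_def by (rule subspace_supp_on)
  have ker: "f = 0" if f: "f \<in> L" "F f = 0" for f
  proof -
    have row: "sy f (i, j) = 0" for i j
    proof -
      let ?x = "\<lambda>k. sy f (i, k)"
      have "?x \<in> vecs n" using sm[OF f(1)] by (auto simp: supp_on_def)
      moreover have "tapp n G ?x = 0"
      proof
        fix j
        have "tapp n G ?x j = F f (i, j)" by (simp add: tapp_def F_def matmul_def)
        then show "tapp n G ?x j = 0 j" using f(2) by (simp add: pointwise)
      qed
      ultimately have "?x = 0" by (rule G_nondeg)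
      then show ?thesis by (metis zero_fun_apply)
    qed
    show ?thesis
    proof
      fix p :: "nat \<times> nat" obtain i j where p: "p = (i, j)" by (cases p)
      show "f p = 0 p"
      proof (cases "j \<le> i")
        case True then show ?thesis using row[of i j] by (simp add: p sy_def max_def min_def pointwise split: if_splits)
      next
        case False then show ?thesis using f(1) by (simp add: p L_def supp_on_def lower_pairs_def pointwise)
      qed
    qed
  qed
  have inj: "inj_on F L"
  proof (rule inj_onI)
    fix f g assume *: "f \<in> L" "g \<in> L" "F f = F g"
    have "f - g = 0" by (rule ker) (use * in \<open>auto simp: fs.subspace_diff[OF sL] F.diff\<close>)
    then show "f = g" by simp
  qed
  define X where "X = F ` L"
  have X: "fs.subspace X" unfolding X_def by (rule F.subspace_image[OF sL])
  have "fs.dim X = fs.dim L" unfolding X_def by (rule dim_inj_image[OF lin sL inj])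
  then have dX: "card (lower_pairs n) \<le> fs.dim X"
    using dim_supp_on[OF finite_lower_pairs, where 'a = 'a] by (simp add: L_def)
  have XV: "X \<subseteq> V" unfolding X_def F_def using sym_matmul_in_V[OF sm sym] by auto
  obtain x where x: "good {} x" using ex_good[of "{}"] by auto
  obtain xs where "xs 0 = x" and xs: "\<And>i. i < n \<Longrightarrow> good (xs ` {..<i}) (xs i)" "flag_basis n xs"
    by (rule ex_good_flag[OF x]) blast
  have triv: "V \<inter> strict_upper n xs \<subseteq> {0}" by (rule good_flag_trivial[OF xs])
  obtain B where B: "B \<in> X" "A - B \<in> strict_upper n xs"
  proof (rule strict_upper_complement[OF xs(2) X _ _ dX])
    show "X \<subseteq> mats n" "X \<inter> strict_upper n xs \<subseteq> {0}" "A \<in> mats n" using XV V_mats triv A by auto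
  qed
  have "A - B \<in> V" using fs.subspace_diff[OF V_sub A] B(1) XV by blast
  then have "A = B" using B(2) triv by auto
  then obtain f where "f \<in> L" "A = matmul n (sy f) G" using B(1) by (auto simp: X_def F_def)
  then show thesis using that[of "sy f"] sm sym by blast
qed

text \<open>The identity is a product \<open>S G\<close> with \<open>S\<close> symmetric, so \<open>G\<close> is
  the inverse of a symmetric matrix.\<close>

lemma G_symmetric:
  assumes x: "x \<in> vecs n" and y: "y \<in> vecs n"
  shows "dot n x (app n G y) = dot n y (app n G x)"
proof -
  obtain S where S: "S \<in> mats n" "\<And>i j. S (i, j) = S (j, i)" "idmat n = matmul n S G"
    by (rule V_sym_matmul[OF idmat_in_V]) blast
  have inv: "app n S (app n G z) = z" if "z \<in> vecs n" for z
    using app_idmat[OF that] by (simp add: S(3) app_matmul)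
  have "dot n x (app n G y) = dot n (app n S (app n G x)) (app n G y)" by (simp add: inv[OF x])
  also have "\<dots> = dot n (app n G x) (app n S (app n G y))" by (rule dot_app_sym[where S = S, OF S(2), symmetric])
  finally show ?thesis by (simp add: inv[OF y] dot_commute)
qed

definition B where "B x y = dot n x (app n G y)"

lemma B_linear [simp]:
  "B (x + y) z = B x z + B y z" "B z (x + y) = B z x + B z y"
  "B (x - y) z = B x z - B y z" "B z (x - y) = B z x - B z y"
  "B (c *f x) z = c * B x z" "B z (c *f x) = c * B z x" "B 0 z = 0" "B z 0 = 0"
  by (simp_all add: B_def)

lemma B_sum: "B z (\<Sum>k\<in>K. f k) = (\<Sum>k\<in>K. B z (f k))" "B (\<Sum>k\<in>K. f k) z = (\<Sum>k\<in>K. B (f k) z)"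
  by (simp_all add: B_def app_sum dot_sum)

lemma B_sym: "x \<in> vecs n \<Longrightarrow> y \<in> vecs n \<Longrightarrow> B x y = B y x"
  by (simp add: B_def G_symmetric)

lemma B_nondeg: "x \<in> vecs n \<Longrightarrow> (\<And>y. y \<in> vecs n \<Longrightarrow> B x y = 0) \<Longrightarrow> x = 0"
  by (rule G_nondeg, assumption, rule dot_nondegenerate[of _ n])
    (simp_all add: B_def dot_tapp G_mats tapp_in_vecs)

lemma sym_squares:
  assumes x: "x \<in> vecs n" and y: "y \<in> vecs n"
  obtains A where "A \<in> V" "\<And>v. app n A v = (c * B x v) *f x + B y v *f y"
proof
  show "matmul n (c *f outer x x + outer y y) G \<in> V"
  proof (rule sym_matmul_in_V)
    show "c *f outer x x + outer y y \<in> mats n" using x y by blast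
  qed (simp add: outer_def pointwise mult.commute add.commute)
qed (simp add: app_matmul B_def)

lemma sym_product:
  assumes x: "x \<in> vecs n" and y: "y \<in> vecs n"
  obtains A where "A \<in> V" "\<And>v. app n A v = B y v *f x + B x v *f y"
proof
  show "matmul n (outer x y + outer y x) G \<in> V"
  proof (rule sym_matmul_in_V)
    show "outer x y + outer y x \<in> mats n" using x y by blast
  qed (simp add: outer_def pointwise mult.commute add.commute)
qed (simp add: app_matmul B_def)

text \<open>On a hyperbolic pair, \<open>c x x\<^sup>T + y y\<^sup>T\<close> times \<open>G\<close> exchanges the
  two isotropic lines.\<close>

lemma no_hyperbolic_pair:
  assumes x: "x \<in> vecs n" "B x x = 0" and y: "y \<in> vecs n" "B y y = 0"
  shows "B x y = 0"
proof (rule ccontr)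
  assume b: "B x y \<noteq> 0"
  define c where "c = nonsq / (B x y * B x y)"
  obtain A where A: "A \<in> V" "\<And>v. app n A v = (c * B x v) *f x + B y v *f y"
    by (rule sym_squares[OF x(1) y(1)]) blast
  have "\<exists>l. l * l = B x y * (c * B x y)"
  proof (rule flag_split_plane[OF V_split[OF A(1)] _ _ _ x(1) y(1)])
    show "fs.subspace {0::nat \<Rightarrow> 'a}" by (rule fs.subspace_single_0)
    fix r s assume "r *f x + s *f y \<in> {0}"
    then have "r *f x + s *f y = 0" by simp
    then have "B (r *f x + s *f y) y = 0" "B (r *f x + s *f y) x = 0" by simp_all
    then show "r = 0 \<and> s = 0" using x y b B_sym[OF x(1) y(1)] by simp
  qed (use x y B_sym[OF x(1) y(1)] in \<open>auto simp: A(2)\<close>)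
  then show False using nonsq b by (simp add: c_def)
qed

text \<open>The product of \<open>x y\<^sup>T + y x\<^sup>T\<close> and \<open>G\<close> exchanges the lines of
  \<open>x\<close> and \<open>y\<close>.\<close>

lemma orthogonal_square:
  assumes x: "x \<in> vecs n" "B x x \<noteq> 0" and y: "y \<in> vecs n" "B y y \<noteq> 0" and xy: "B x y = 0"
  shows "\<exists>l. l * l = B x x * B y y"
proof -
  obtain A where A: "A \<in> V" "\<And>v. app n A v = B y v *f x + B x v *f y"
    by (rule sym_product[OF x(1) y(1)]) blast
  have yx: "B y x = 0" using xy B_sym[OF x(1) y(1)] by simp
  show ?thesis
  proof (rule flag_split_plane[OF V_split[OF A(1)] _ _ _ x(1) y(1)])
    show "fs.subspace {0::nat \<Rightarrow> 'a}" by (rule fs.subspace_single_0)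
    fix r s assume "r *f x + s *f y \<in> {0}"
    then have "r *f x + s *f y = 0" by simp
    then have "B (r *f x + s *f y) y = 0" "B (r *f x + s *f y) x = 0" by simp_all
    then show "r = 0 \<and> s = 0" using x y xy yx by simp
  qed (use xy yx in \<open>auto simp: A(2)\<close>)
qed

text \<open>If all vectors orthogonal to the ones chosen so far were isotropic, then nondegeneracy would provide a
  hyperbolic pair among them; this replaces the usual polarization argument, which fails in
  characteristic two. The last step rescales by square roots of \<open>d * B (p i) (p i)\<close>.\<close>

lemma ex_orthogonal_basis:
  obtains p d where "d \<noteq> 0" "\<And>i. i < n \<Longrightarrow> p i \<in> vecs n" "\<And>i. i < n \<Longrightarrow> B (p i) (p i) = d"
    "\<And>i j. i < n \<Longrightarrow> j < n \<Longrightarrow> i \<noteq> j \<Longrightarrow> B (p i) (p j) = 0"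
proof -
  define ok where "ok p k \<longleftrightarrow> (\<forall>i<k. p i \<in> vecs n \<and> B (p i) (p i) \<noteq> 0 \<and> (\<forall>j<k. i \<noteq> j \<longrightarrow> B (p i) (p j) = 0))"
    for p and k :: nat
  have "\<exists>p. ok p k" if "k \<le> n" for k
    using that
  proof (induction k)
    case 0 show ?case by (simp add: ok_def)
  next
    case (Suc k)
    then obtain p where p: "ok p k" by auto
    have pv: "p i \<in> vecs n" "B (p i) (p i) \<noteq> 0" if "i < k" for i using p that by (auto simp: ok_def)
    have po: "B (p i) (p j) = 0" if "i < k" "j < k" "i \<noteq> j" for i j using p that by (auto simp: ok_def)
    let ?K = "{x \<in> vecs n. \<forall>i<k. B x (p i) = 0}"
    have "\<exists>x\<in>?K. B x x \<noteq> 0"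
    proof (rule ccontr)
      assume iso: "\<not> (\<exists>x\<in>?K. B x x \<noteq> 0)"
      have c: "card ((\<lambda>i. app n G (p i)) ` {..<k}) < n"
        using card_image_le[of "{..<k}" "\<lambda>i. app n G (p i)"] Suc.prems by simp
      obtain x where x: "x \<in> vecs n" "x \<noteq> 0" "\<And>v. v \<in> (\<lambda>i. app n G (p i)) ` {..<k} \<Longrightarrow> dot n x v = 0"
        by (rule nonzero_annihilator[OF _ c]) (use G_mats in auto)
      have xK: "x \<in> ?K" using x by (auto simp: B_def)
      have xx: "B x x = 0" using iso xK by blast
      obtain y where y: "y \<in> vecs n" "B x y \<noteq> 0" using B_nondeg[OF x(1)] x(2) by blast
      \<comment> \<open>removing the components along the \<open>p i\<close> does not change the product with \<open>x\<close>\<close>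
      define z where "z = y - (\<Sum>i<k. (B y (p i) / B (p i) (p i)) *f p i)"
      have sv: "(\<Sum>i<k. (B y (p i) / B (p i) (p i)) *f p i) \<in> vecs n"
        using pv(1) by (intro fs.subspace_sum[OF subspace_supp_on]) auto
      have zv: "z \<in> vecs n" using y(1) sv by (simp add: z_def)
      have "B z (p j) = 0" if j: "j < k" for j
      proof -
        have "(\<Sum>i<k. B y (p i) / B (p i) (p i) * B (p i) (p j)) = (\<Sum>i<k. if i = j then B y (p j) else 0)"
          using po pv(2) j by (intro sum.cong) auto
        also have "\<dots> = B y (p j)" using j by simp
        finally show ?thesis by (simp add: z_def B_sum)
      qed
      then have zK: "z \<in> ?K" using zv by simp
      have zz: "B z z = 0" using iso zK by blast
      have "B x z = B x y" using xK by (simp add: z_def B_sum)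
      then show False using no_hyperbolic_pair[OF x(1) xx zv zz] y(2) by simp
    qed
    then obtain x where x: "x \<in> vecs n" "\<And>i. i < k \<Longrightarrow> B x (p i) = 0" "B x x \<noteq> 0" by blast
    have x': "B (p i) x = 0" if "i < k" for i using x(2)[OF that] B_sym[OF x(1) pv(1)[OF that]] by simp
    have "ok (p(k := x)) (Suc k)"
      unfolding ok_def using pv po x x' by (auto simp: less_Suc_eq)
    then show ?case by blast
  qed
  then obtain p where p: "ok p n" by blast
  have pv: "p i \<in> vecs n" "B (p i) (p i) \<noteq> 0" if "i < n" for i using p that by (auto simp: ok_def)
  have po: "B (p i) (p j) = 0" if "i < n" "j < n" "i \<noteq> j" for i j using p that by (auto simp: ok_def)
  define d where "d = B (p 0) (p 0)"
  have d: "d \<noteq> 0" using pv(2)[OF n_pos] by (simp add: d_def)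
  have "\<exists>l. l * l = d * B (p i) (p i)" if i: "i < n" for i
  proof (cases "i = 0")
    case True then show ?thesis by (auto simp: d_def)
  next
    case False
    then show ?thesis unfolding d_def
      using orthogonal_square[OF pv(1)[OF n_pos] pv(2)[OF n_pos] pv(1)[OF i] pv(2)[OF i]] po[OF n_pos i] by auto
  qed
  then obtain l where l: "\<And>i. i < n \<Longrightarrow> l i * l i = d * B (p i) (p i)" by metis
  define q where "q i = (l i / B (p i) (p i)) *f p i" for i
  show thesis
  proof (rule that[OF d])
    show "q i \<in> vecs n" if "i < n" for i using pv(1)[OF that] by (simp add: q_def)
    show "B (q i) (q j) = 0" if "i < n" "j < n" "i \<noteq> j" for i j using po[OF that] by (simp add: q_def)
    show "B (q i) (q i) = d" if "i < n" for i
      using l[OF that] pv(2)[OF that] by (simp add: q_def field_simps)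
  qed
qed

end

text \<open>The form is \<open>b(e i, y) = f i y\<close> for a basis and forms as in \<open>ex_skew_basis\<close>;
  since the array \<open>f i (N (e j))\<close> is alternating, \<open>b(x, N x)\<close> vanishes.\<close>

lemma (in irreducible_space) ex_form:
  obtains G where "form_space n V nonsq G"
proof -
  obtain e f where ef: "flag_basis n e" "\<And>c. (\<Sum>i<n. c i *f f i) = 0 \<Longrightarrow> \<forall>i<n. c i = 0"
    and fv: "\<And>i. i < n \<Longrightarrow> f i \<in> vecs n"
    and f0: "\<And>i N. i < n \<Longrightarrow> N \<in> perp \<Longrightarrow> dot n (f i) (app n N (e i)) = 0"
    and f1: "\<And>i j N. i < n \<Longrightarrow> j < n \<Longrightarrow> i \<noteq> j \<Longrightarrow> N \<in> perp \<Longrightarrow>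
      dot n (f i) (app n N (e j)) = - dot n (f j) (app n N (e i))"
    by (rule ex_skew_basis) blast
  have "\<exists>c. unit_fun i = (\<Sum>k<n. c k *f e k)" if "i < n" for i
  proof -
    have "unit_fun i \<in> fs.span (e ` {..<n})" using that flag_basis_span[OF ef(1)] by simp
    then show ?thesis by (rule span_prefix_sum) blast
  qed
  then obtain C where C: "\<And>i. i < n \<Longrightarrow> unit_fun i = (\<Sum>k<n. C i k *f e k)" by metis
  define G where "G = (\<lambda>(i, j). if i < n then \<Sum>k<n. C i k * f k j else 0)"
  have rep: "\<exists>c. x = (\<Sum>k<n. c k *f e k) \<and> tapp n G x = (\<Sum>k<n. c k *f f k)" if x: "x \<in> vecs n" for x
  proof (intro exI[of _ "\<lambda>k. \<Sum>i<n. x i * C i k"] conjI)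
    have "x = (\<Sum>i<n. x i *f unit_fun i)" by (rule supp_on_expand[OF _ x]) simp
    also have "\<dots> = (\<Sum>i<n. x i *f (\<Sum>k<n. C i k *f e k))"
      using C by (intro sum.cong) auto
    also have "\<dots> = (\<Sum>i<n. \<Sum>k<n. (x i * C i k) *f e k)" by (simp add: fs.scale_sum_right)
    also have "\<dots> = (\<Sum>k<n. \<Sum>i<n. (x i * C i k) *f e k)" by (rule sum.swap)
    finally show "x = (\<Sum>k<n. (\<Sum>i<n. x i * C i k) *f e k)" by (simp add: fs.scale_sum_left)
    show "tapp n G x = (\<Sum>k<n. (\<Sum>i<n. x i * C i k) *f f k)"
    proof
      fix j
      have "tapp n G x j = (\<Sum>i<n. \<Sum>k<n. x i * C i k * f k j)"
        by (simp add: tapp_def G_def sum_distrib_left mult.assoc)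
      also have "\<dots> = (\<Sum>k<n. \<Sum>i<n. x i * C i k * f k j)" by (rule sum.swap)
      finally show "tapp n G x j = (\<Sum>k<n. (\<Sum>i<n. x i * C i k) *f f k) j"
        by (simp add: pointwise sum_distrib_right)
    qed
  qed
  show thesis
  proof (rule that, unfold_locales)
    have "f k j = 0" if "k < n" "\<not> j < n" for k j using fv[OF that(1)] that(2) by (auto simp: supp_on_def)
    then show "G \<in> mats n" by (auto simp: G_def supp_on_def intro!: sum.neutral)
  next
    fix x :: "nat \<Rightarrow> 'a" assume x: "x \<in> vecs n" "tapp n G x = 0"
    obtain c where c: "x = (\<Sum>k<n. c k *f e k)" "tapp n G x = (\<Sum>k<n. c k *f f k)" using rep[OF x(1)] by blast
    have "\<forall>i<n. c i = 0" using ef(2) c(2) x(2) by simp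
    then show "x = 0" by (simp add: c(1))
  next
    fix x :: "nat \<Rightarrow> 'a" and N assume x: "x \<in> vecs n" and N: "N \<in> perp"
    obtain c where c: "x = (\<Sum>k<n. c k *f e k)" "tapp n G x = (\<Sum>k<n. c k *f f k)" using rep[OF x] by blast
    have "dot n (tapp n G x) (app n N x) = (\<Sum>i<n. \<Sum>j<n. c i * (c j * dot n (f i) (app n N (e j))))"
    proof -
      have "dot n (tapp n G x) (app n N x) = (\<Sum>j<n. \<Sum>i<n. c j * (c i * dot n (f i) (app n N (e j))))"
        unfolding c(2) by (subst c(1)) (simp add: dot_sum app_sum sum_distrib_left)
      also have "\<dots> = (\<Sum>i<n. \<Sum>j<n. c i * (c j * dot n (f i) (app n N (e j))))"
        by (subst sum.swap) (simp add: mult.left_commute)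
      finally show ?thesis .
    qed
    also have "\<dots> = 0"
    proof (rule sum_alternating)
      show "c i * (c i * dot n (f i) (app n N (e i))) = 0" if "i < n" for i using f0[OF that N] by simp
      show "c i * (c j * dot n (f i) (app n N (e j))) = - (c j * (c i * dot n (f j) (app n N (e i))))"
        if "i < n" "j < n" "i \<noteq> j" for i j
        using f1[OF that N] by simp
    qed
    finally show "dot n (tapp n G x) (app n N x) = 0" .
  qed
qed

section \<open>Transfer to matrices\<close>

definition entries :: "nat \<Rightarrow> 'a::field mat \<Rightarrow> nat \<times> nat \<Rightarrow> 'a"
  where "entries n A = (\<lambda>(i, j). if i < n \<and> j < n then A $$ (i, j) else 0)"

lemma entries_mats [simp]: "entries n A \<in> mats n"
  by (auto simp: entries_def supp_on_def)

lemma mat_entries [simp]: "A \<in> carrier_mat n n \<Longrightarrow> mat n n (entries n A) = A"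
  by (intro eq_matI) (auto simp: entries_def)

lemma entries_mat: "f \<in> mats n \<Longrightarrow> entries n (mat n n f) = f"
  by (auto simp: entries_def supp_on_def fun_eq_iff)

lemma entries_inj: "inj_on (entries n) (carrier_mat n n)"
  by (rule inj_on_inverseI[of _ "mat n n"]) simp

lemma entries_linear:
  "A \<in> carrier_mat n n \<Longrightarrow> B \<in> carrier_mat n n \<Longrightarrow> entries n (A + B) = entries n A + entries n B"
  "A \<in> carrier_mat n n \<Longrightarrow> entries n (c \<cdot>\<^sub>m A) = c *f entries n A"
  "entries n (0\<^sub>m n n) = 0"
  by (auto simp: entries_def fun_eq_iff pointwise)

lemma entries_mult:
  assumes "A \<in> carrier_mat n n" "B \<in> carrier_mat n n"
  shows "entries n (A * B) = matmul n (entries n A) (entries n B)"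
proof
  fix p :: "nat \<times> nat" obtain i j where p: "p = (i, j)" by (cases p)
  have "A $$ (i, k) * B $$ (k, j) = entries n A (i, k) * entries n B (k, j)" if "i < n" "j < n" "k < n" for k
    using that by (simp add: entries_def)
  then show "entries n (A * B) p = matmul n (entries n A) (entries n B) p"
    using assms by (auto simp: p entries_def matmul_def scalar_prod_def atLeast0LessThan intro!: sum.cong)
qed

lemma entries_one: "entries n (1\<^sub>m n) = idmat n"
  by (auto simp: entries_def idmat_def fun_eq_iff)

lemma mult_vec_app:
  assumes "A \<in> carrier_mat n n"
  shows "A *\<^sub>v vec n x = vec n (app n (entries n A) x)"
  using assms by (intro eq_vecI) (auto simp: app_def entries_def scalar_prod_def atLeast0LessThan)

lemma mat_subspace_iff:
  "mat_subspace n (V :: 'a::field mat set) \<longleftrightarrow> V \<subseteq> carrier_mat n n \<and> 0\<^sub>m n n \<in> V \<and>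
    (\<forall>A\<in>V. \<forall>B\<in>V. A + B \<in> V) \<and> (\<forall>c. \<forall>A\<in>V. c \<cdot>\<^sub>m A \<in> V)"
proof -
  have "vectorspace class_ring (module_mat TYPE('a) n n)" by (rule matrix_vs)
  moreover from this have "Module.module class_ring (module_mat TYPE('a) n n)"
    by (simp add: vectorspace_def)
  ultimately show ?thesis
    by (auto simp: mat_subspace_def VectorSpace.subspace_def submodule_def module_mat_simps)
qed

lemma entries_subspace:
  assumes "mat_subspace n V" shows "fs.subspace (entries n ` V)"
proof -
  have V: "V \<subseteq> carrier_mat n n" "0\<^sub>m n n \<in> V" "\<And>A B. A \<in> V \<Longrightarrow> B \<in> V \<Longrightarrow> A + B \<in> V"
    "\<And>c A. A \<in> V \<Longrightarrow> c \<cdot>\<^sub>m A \<in> V"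
    using assms by (auto simp: mat_subspace_iff)
  show ?thesis
  proof (rule fs.subspaceI)
    show "0 \<in> entries n ` V" using V(2) by (rule image_eqI[rotated]) (simp add: entries_linear)
    fix x y assume "x \<in> entries n ` V" "y \<in> entries n ` V"
    then obtain A B where *: "A \<in> V" "B \<in> V" "x = entries n A" "y = entries n B" by blast
    then have "x + y = entries n (A + B)" using V(1) by (simp add: entries_linear subset_iff)
    then show "x + y \<in> entries n ` V" using V(3)[OF *(1,2)] by blast
  next
    fix c x assume "x \<in> entries n ` V"
    then obtain A where *: "A \<in> V" "x = entries n A" by blast
    then have "c *f x = entries n (c \<cdot>\<^sub>m A)" using V(1) by (simp add: entries_linear subset_iff)
    then show "c *f x \<in> entries n ` V" using V(4)[OF *(1)] by blast
  qed
qed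

text \<open>Both dimensions are the least size of a spanning set, and \<open>entries\<close> preserves spans.\<close>

lemma mat_subspace_dim_entries:
  fixes V :: "'a::field mat set"
  assumes V: "mat_subspace n V"
  shows "mat_subspace_dim n V = fs.dim (entries n ` V)"
proof -
  let ?M = "module_mat TYPE('a) n n"
  let ?W = "?M\<lparr>carrier := V\<rparr>"
  have Vc: "V \<subseteq> carrier_mat n n" using V by (simp add: mat_subspace_iff)
  have W: "vectorspace class_ring ?W"
    using vectorspace.subspace_is_vs[OF matrix_vs] V unfolding mat_subspace_def by blast
  then interpret W: vectorspace class_ring ?W .
  have sm: "submodule class_ring N ?W \<longleftrightarrow> N \<subseteq> V \<and> mat_subspace n N" for N
    using Vc W.module_axioms by (auto simp: mat_subspace_iff submodule_def module_mat_simps)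
  have span: "entries n ` W.span A = fs.span (entries n ` A)" if A: "A \<subseteq> V" for A
  proof
    let ?N = "{B \<in> V. entries n B \<in> fs.span (entries n ` A)}"
    have "mat_subspace n ?N"
      using V Vc by (auto simp: mat_subspace_iff entries_linear subset_iff fs.span_zero fs.span_add fs.span_scale)
    then have "submodule class_ring ?N ?W" by (simp add: sm)
    moreover have "A \<subseteq> ?N" using A fs.span_superset[of "entries n ` A"] by auto
    ultimately have "W.span A \<subseteq> ?N" by (intro W.span_is_subset)
    then show "entries n ` W.span A \<subseteq> fs.span (entries n ` A)" by blast
    have "submodule class_ring (W.span A) ?W" by (rule W.span_is_submodule) (use A in simp)
    then have "mat_subspace n (W.span A)" by (simp add: sm)
    then show "fs.span (entries n ` A) \<subseteq> entries n ` W.span A"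
      using W.in_own_span[of A] A by (intro fs.span_minimal entries_subspace) auto
  qed
  have spanV: "W.span A \<subseteq> V" if "A \<subseteq> V" for A using W.span_is_subset2[of A] that by simp
  obtain Bs where Bs: "Bs \<subseteq> entries n ` V" "fs.independent Bs" "entries n ` V \<subseteq> fs.span Bs"
      "card Bs = fs.dim (entries n ` V)"
    by (rule fs.basis_exists)
  have fB: "finite Bs"
    using finite_independent_supp_on[OF _ Bs(2), of "{..<n} \<times> {..<n}"] Bs(1) by fastforce
  have "W.dim = fs.dim (entries n ` V)"
    unfolding W.dim_def
  proof (rule Least_equality)
    obtain A where A: "A \<subseteq> V" "Bs = entries n ` A" using Bs(1) by (auto simp: subset_image_iff)
    have inj: "inj_on (entries n) V" by (rule inj_on_subset[OF entries_inj Vc])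
    have injA: "inj_on (entries n) A" by (rule inj_on_subset[OF inj A(1)])
    have "fs.span Bs = entries n ` V"
      using fs.span_minimal[OF Bs(1) entries_subspace[OF V]] Bs(3) by blast
    then have "entries n ` W.span A = entries n ` V" using span[OF A(1)] A(2) by simp
    then have "W.span A = V" using inj_on_image_eq_iff[OF inj spanV[OF A(1)] order_refl] by simp
    moreover have "finite A" "card A = card Bs"
      using fB A(2) injA by (auto simp: card_image finite_image_iff)
    ultimately show "\<exists>A. finite A \<and> card A = fs.dim (entries n ` V) \<and> A \<subseteq> carrier ?W \<and> W.span A = carrier ?W"
      using A Bs(4) by (intro exI[of _ A]) simp
  next
    fix k assume "\<exists>A. finite A \<and> card A = k \<and> A \<subseteq> carrier ?W \<and> W.span A = carrier ?W"
    then obtain A where A: "finite A" "card A = k" "A \<subseteq> V" "W.span A = V" by auto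
    have "fs.dim (entries n ` V) \<le> card (entries n ` A)"
      using span[OF A(3)] A(1,4) by (intro fs.dim_le_card) auto
    also have "\<dots> \<le> k" using card_image_le[OF A(1)] A(2) by blast
    finally show "fs.dim (entries n ` V) \<le> k" .
  qed
  then show ?thesis by (simp add: mat_subspace_dim_def)
qed

lemma mat_subspace_dim_bound:
  assumes "mat_subspace n (V :: 'a::field mat set)" shows "mat_subspace_dim n V \<le> card ({..<n} \<times> {..<n})"
proof -
  have "entries n ` V \<subseteq> fs.span (unit_fun ` ({..<n} \<times> {..<n}))" by (subst span_unit_funs) auto
  then have "fs.dim (entries n ` V) \<le> card (unit_fun ` ({..<n} \<times> {..<n}) :: (nat \<times> nat \<Rightarrow> 'a) set)"
    by (rule fs.dim_le_card) simp
  then show ?thesis by (simp add: mat_subspace_dim_entries[OF assms] card_unit_funs)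
qed

text \<open>The upper triangular matrices form a weakly triangularizable space of this dimension.\<close>

lemma triangular_le_max_triang_dim: "card (lower_pairs n) \<le> max_triang_dim TYPE('a::field) n"
  unfolding max_triang_dim_def
proof (rule Greatest_le_nat)
  let ?T = "{A :: 'a mat. A \<in> carrier_mat n n \<and> upper_triangular A}"
  let ?I = "(\<lambda>(i, j). (j, i)) ` lower_pairs n"
  have T: "mat_subspace n ?T" by (auto simp: mat_subspace_iff upper_triangular_def)
  have "triangularizable A" if "A \<in> ?T" for A
    unfolding triangularizable_def using that similar_mat_refl[of A n] by blast
  then have "weakly_triangularizable n ?T" using T by (simp add: weakly_triangularizable_def)
  moreover have "mat_subspace_dim n ?T = card (lower_pairs n)"
  proof -
    have I: "(i, j) \<in> ?I \<longleftrightarrow> i \<le> j \<and> j < n" for i j by (force simp: lower_pairs_def)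
    have "entries n ` ?T = (supp_on ?I :: (nat \<times> nat \<Rightarrow> 'a) set)"
    proof
      show "entries n ` ?T \<subseteq> supp_on ?I"
        by (auto simp: entries_def supp_on_def upper_triangular_def I)
      show "supp_on ?I \<subseteq> entries n ` ?T"
      proof
        fix f :: "nat \<times> nat \<Rightarrow> 'a" assume f: "f \<in> supp_on ?I"
        then have "f \<in> mats n" by (auto simp: supp_on_def I)
        then have "f = entries n (mat n n f)" by (simp add: entries_mat)
        moreover have "mat n n f \<in> ?T" using f by (auto simp: supp_on_def upper_triangular_def I)
        ultimately show "f \<in> entries n ` ?T" by blast
      qed
    qed
    moreover have "fs.dim (supp_on ?I :: (nat \<times> nat \<Rightarrow> 'a) set) = card ?I"
      by (rule dim_supp_on) (simp add: finite_lower_pairs)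
    moreover have "card ?I = card (lower_pairs n)" by (rule card_image) (auto simp: inj_on_def)
    ultimately show ?thesis using mat_subspace_dim_entries[OF T] by argo
  qed
  ultimately show "\<exists>V :: 'a mat set. weakly_triangularizable n V \<and> mat_subspace_dim n V = card (lower_pairs n)"
    by blast
  show "y \<le> card ({..<n} \<times> {..<n})"
    if "\<exists>V :: 'a mat set. weakly_triangularizable n V \<and> mat_subspace_dim n V = y" for y
    using that mat_subspace_dim_bound by (auto simp: weakly_triangularizable_def)
qed

text \<open>In coordinates \<open>q v\<close> adapted to the triangular form, take \<open>v \<in> F - E\<close>
  whose coordinates vanish from the least possible index \<open>j\<close> on. Subtracting the diagonal
  entry number \<open>j - 1\<close> times \<open>v\<close> from \<open>A v\<close> shortens it
  further, so the difference lies in \<open>E\<close>.\<close>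

lemma triangularizable_flag_split:
  assumes A: "A \<in> carrier_mat n n" and tri: "triangularizable A"
  shows "flag_split n (entries n A)"
proof -
  obtain T where T: "similar_mat A T" "upper_triangular T" using tri by (auto simp: triangularizable_def)
  obtain m P Q where *: "{A, T, P, Q} \<subseteq> carrier_mat m m" "P * Q = 1\<^sub>m m" "Q * P = 1\<^sub>m m" "A = P * T * Q"
    using similar_matD[OF T(1)] by blast
  have m: "m = n" using * A by auto
  have c: "T \<in> carrier_mat n n" "P \<in> carrier_mat n n" "Q \<in> carrier_mat n n" using * m by auto
  define p q t where "p = entries n P" and "q = entries n Q" and "t = entries n T"
  have pq: "app n p (app n q v) = v" "app n q (app n p v) = v" if "v \<in> vecs n" for v
    using arg_cong[OF *(2), of "entries n"] arg_cong[OF *(3), of "entries n"] that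
    by (simp_all add: m p_def q_def entries_mult c entries_one flip: app_matmul)
  have av: "app n (entries n A) v = app n p (app n t (app n q v))" for v
    using c by (simp add: *(4) p_def q_def t_def entries_mult app_matmul)
  have mats: "p \<in> mats n" "q \<in> mats n" "t \<in> mats n" by (simp_all add: p_def q_def t_def)
  have t0: "t (i, k) = 0" if "k < i" for i k
    using T(2) c(1) that by (auto simp: t_def entries_def upper_triangular_def)
  show ?thesis
    unfolding flag_split_def
  proof (intro allI impI)
    fix E F
    assume E: "fs.subspace E" and F: "fs.subspace F" and EF: "E \<subset> F" and Fv: "F \<subseteq> vecs n"
      and "app n (entries n A) ` E \<subseteq> E" and AF: "app n (entries n A) ` F \<subseteq> F"
    define R where "R j \<longleftrightarrow> (\<exists>v\<in>F - E. \<forall>i\<ge>j. app n q v i = 0)" for j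
    have "R n"
    proof -
      obtain v where v: "v \<in> F - E" using EF by blast
      have "app n q v \<in> vecs n" using mats by simp
      then have "\<forall>i\<ge>n. app n q v i = 0" by (auto simp: supp_on_def)
      then show ?thesis using v by (auto simp: R_def)
    qed
    define j where "j = (LEAST j. R j)"
    have "R j" unfolding j_def by (rule LeastI[of R, OF \<open>R n\<close>])
    then obtain v where v: "v \<in> F" "v \<notin> E" and qv: "\<And>i. j \<le> i \<Longrightarrow> app n q v i = 0" by (auto simp: R_def)
    have vv: "v \<in> vecs n" using v Fv by blast
    have "j \<noteq> 0"
    proof
      assume "j = 0"
      then have "app n q v = 0" using qv by (auto simp: fun_eq_iff pointwise)
      then have "v = 0" using pq(1)[OF vv] by simp
      then show False using v(2) fs.subspace_0[OF E] by simp
    qed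
    then obtain l where l: "j = Suc l" by (cases j) auto
    let ?y = "app n q v"
    let ?w = "app n (entries n A) v - t (l, l) *f v"
    have wF: "?w \<in> F"
      by (rule fs.subspace_diff[OF F _ fs.subspace_scale[OF F v(1)]]) (use AF v in blast)
    have "app n q ?w i = 0" if i: "l \<le> i" for i
    proof -
      have "app n q ?w i = app n t ?y i - t (l, l) * ?y i"
        using pq(2)[OF app_in_vecs[OF mats(3)]] by (simp add: av pointwise)
      also have "app n t ?y i = (\<Sum>k<n. if k = l then t (i, l) * ?y l else 0)"
        unfolding app_def[of n t]
      proof (intro sum.cong refl)
        fix k assume "k \<in> {..<n}"
        show "t (i, k) * ?y k = (if k = l then t (i, l) * ?y l else 0)"
          using t0[of k i] qv[of k] i l by (cases "k < l") (auto simp: not_less_eq_eq)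
      qed
      also have "\<dots> = t (i, l) * ?y l"
        using mats by (auto simp: supp_on_def)
      finally show ?thesis using i l t0[of l i] qv[of i] by (cases "i = l") auto
    qed
    then have "?w \<in> E" using Least_le[of R l] wF l unfolding j_def[symmetric] by (force simp: R_def)
    then show "\<exists>v\<in>F - E. \<exists>c. app n (entries n A) v - c *f v \<in> E" using v by blast
  qed
qed

lemma irreducible_entries:
  fixes M :: "'a::field mat set"
  assumes irr: "irreducible_mat_space n M" and E: "fs.subspace E" "E \<subseteq> vecs n"
    and inv: "\<And>A v. A \<in> entries n ` M \<Longrightarrow> v \<in> E \<Longrightarrow> app n A v \<in> E"
  shows "E = {0} \<or> E = vecs n"
proof -
  let ?W = "vec n ` E"
  have vs: "vectorspace class_ring (module_vec TYPE('a) n)" by (rule vec_vs)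
  have add: "vec n x + vec n y = vec n (x + y)" and sc: "c \<cdot>\<^sub>v vec n x = vec n (c *f x)"
    and z: "0\<^sub>v n = vec n (0 :: nat \<Rightarrow> 'a)" for x y :: "nat \<Rightarrow> 'a" and c
    by (auto simp: pointwise)
  have "VectorSpace.subspace class_ring ?W (module_vec TYPE('a) n)"
    unfolding VectorSpace.subspace_def submodule_def
    using vs E(1) by (auto simp: vectorspace_def module_vec_simps add sc z fs.subspace_add fs.subspace_scale fs.subspace_0)
  moreover have "\<forall>A\<in>M. \<forall>w\<in>?W. A *\<^sub>v w \<in> ?W"
    using irr inv by (auto simp: irreducible_mat_space_def mat_subspace_iff subset_iff mult_vec_app)
  ultimately have W: "?W = {0\<^sub>v n} \<or> ?W = carrier_vec n"
    using irr by (auto simp: irreducible_mat_space_def)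
  have inj: "x = y" if "x \<in> vecs n" "y \<in> vecs n" "vec n x = vec n y" for x y :: "nat \<Rightarrow> 'a"
  proof
    fix i show "x i = y i"
      using that(1,2) arg_cong[OF that(3), of "\<lambda>v. v $ i"] by (cases "i < n") (auto simp: supp_on_def)
  qed
  from W show ?thesis
  proof
    assume W0: "?W = {0\<^sub>v n}"
    have "x = 0" if "x \<in> E" for x
    proof (rule inj)
      show "vec n x = vec n 0" using imageI[OF that, of "vec n"] unfolding W0 z by simp
    qed (use that E in auto)
    then show ?thesis using fs.subspace_0[OF E(1)] by blast
  next
    assume W1: "?W = carrier_vec n"
    have "x \<in> E" if x: "x \<in> vecs n" for x
    proof -
      have "vec n x \<in> ?W" using W1 by simp
      then obtain y where "y \<in> E" "vec n x = vec n y" by blast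
      then show ?thesis using inj[OF x] E(2) by blast
    qed
    then show ?thesis using E(2) by blast
  qed
qed

theorem theorem1p3:
  fixes n :: nat and M :: "'a::field mat set"
  assumes "infinite (UNIV :: 'a set)"
    and "nrc_field TYPE('a)"
    and "n \<ge> 1"
    and "optimal_weakly_triangularizable n M"
    and "irreducible_mat_space n M"
  shows "similar_mat_sets n M (symmetric_mats n) \<and> (n = 1 \<longrightarrow> M = carrier_mat 1 1)"
proof -
  have M: "mat_subspace n M" "\<And>A. A \<in> M \<Longrightarrow> triangularizable A" "mat_subspace_dim n M = max_triang_dim TYPE('a) n"
    using assms(4) by (auto simp: optimal_weakly_triangularizable_def weakly_triangularizable_def)
  have Mc: "M \<subseteq> carrier_mat n n" using M(1) by (simp add: mat_subspace_iff)
  obtain nonsq :: 'a where nonsq: "\<And>l. l * l \<noteq> nonsq"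
    using assms(2) by (auto simp: nrc_field_def surj_def power2_eq_square) metis
  define V where "V = entries n ` M"
  interpret irreducible_space n V nonsq
  proof
    show "fs.subspace V" unfolding V_def by (rule entries_subspace[OF M(1)])
    show "V \<subseteq> mats n" by (auto simp: V_def)
    show "flag_split n A" if "A \<in> V" for A
      using that triangularizable_flag_split M(2) Mc by (auto simp: V_def)
    show "card (lower_pairs n) \<le> fs.dim V"
      using triangular_le_max_triang_dim[of n, where 'a = 'a] M(3) mat_subspace_dim_entries[OF M(1)]
      by (simp add: V_def)
    show "E = {0} \<or> E = vecs n"
      if "fs.subspace E" "E \<subseteq> vecs n" "\<And>A v. A \<in> V \<Longrightarrow> v \<in> E \<Longrightarrow> app n A v \<in> E" for E
      using irreducible_entries[OF assms(5) that(1,2)] that(3) by (simp add: V_def)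
  qed (use assms(1,3) nonsq in auto)
  obtain G where "form_space n V nonsq G" by (rule ex_form)
  then interpret form_space n V nonsq G .
  obtain p d where d: "d \<noteq> 0" and p: "\<And>i. i < n \<Longrightarrow> p i \<in> vecs n" "\<And>i. i < n \<Longrightarrow> B (p i) (p i) = d"
    "\<And>i j. i < n \<Longrightarrow> j < n \<Longrightarrow> i \<noteq> j \<Longrightarrow> B (p i) (p j) = 0"
    by (rule ex_orthogonal_basis) blast
  define Gm where "Gm = mat n n G"
  define P where "P = mat n n (\<lambda>(i, j). p j i)"
  have c: "Gm \<in> carrier_mat n n" "P \<in> carrier_mat n n" by (auto simp: Gm_def P_def)
  have eG: "entries n Gm = G" by (simp add: Gm_def entries_mat G_mats)
  have Gsym: "transpose_mat Gm = Gm"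
  proof (rule eq_matI)
    fix i j assume "i < dim_row Gm" "j < dim_col Gm"
    then have ij: "i < n" "j < n" using c by auto
    then have "G (i, j) = G (j, i)"
      using G_symmetric[of "unit_fun i" "unit_fun j"]
      by (simp add: dot_commute[of n "unit_fun _"] dot_unit_fun app_unit_fun)
    then show "transpose_mat Gm $$ (i, j) = Gm $$ (i, j)" using ij by (simp add: Gm_def)
  qed (use c in auto)
  have M_iff: "A \<in> M \<longleftrightarrow> (\<exists>S\<in>carrier_mat n n. transpose_mat S = S \<and> A = S * Gm)" for A
  proof
    assume A: "A \<in> M"
    obtain S where S: "S \<in> mats n" "\<And>i j. S (i, j) = S (j, i)" "entries n A = matmul n S G"
      by (rule V_sym_matmul[of "entries n A"]) (use A in \<open>auto simp: V_def\<close>)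
    have "entries n A = entries n (mat n n S * Gm)"
      using S(1,3) c by (simp add: entries_mult entries_mat eG)
    then have "A = mat n n S * Gm" using inj_onD[OF entries_inj] A Mc c by (metis mat_carrier mult_carrier_mat subsetD)
    moreover have "transpose_mat (mat n n S) = mat n n S" by (rule eq_matI) (auto simp: S(2))
    ultimately show "\<exists>S\<in>carrier_mat n n. transpose_mat S = S \<and> A = S * Gm" by (intro bexI[of _ "mat n n S"]) auto
  next
    assume "\<exists>S\<in>carrier_mat n n. transpose_mat S = S \<and> A = S * Gm"
    then obtain S where S: "S \<in> carrier_mat n n" "transpose_mat S = S" "A = S * Gm" by blast
    have "S $$ (i, j) = S $$ (j, i)" if "i < n" "j < n" for i j
      using S(1) that index_transpose_mat(1)[of j S i] by (simp add: S(2))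
    then have "entries n S (i, j) = entries n S (j, i)" for i j by (simp add: entries_def)
    then have "matmul n (entries n S) G \<in> V" by (rule sym_matmul_in_V[OF entries_mats])
    moreover have "matmul n (entries n S) G = entries n A" using S c by (simp add: entries_mult eG)
    ultimately obtain A' where "A' \<in> M" "entries n A = entries n A'" by (auto simp: V_def)
    then show "A \<in> M" using inj_onD[OF entries_inj] S c Mc by (metis mult_carrier_mat subsetD)
  qed
  define K where "K = Gm * P"
  have K: "K \<in> carrier_mat n n" using c by (simp add: K_def)
  have Kt: "transpose_mat K = transpose_mat P * Gm"
    using c Gsym by (simp add: K_def transpose_mult[OF c])
  \<comment> \<open>since \<open>P\<^sup>T G P = d I\<close>, this is the inverse of \<open>P\<close>\<close>
  define X where "X = (1 / d) \<cdot>\<^sub>m transpose_mat K"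
  have X: "X \<in> carrier_mat n n" using K by (simp add: X_def)
  have "transpose_mat P * K = d \<cdot>\<^sub>m 1\<^sub>m n"
  proof (rule eq_matI)
    fix i j assume "i < dim_row (d \<cdot>\<^sub>m 1\<^sub>m n)" "j < dim_col (d \<cdot>\<^sub>m 1\<^sub>m n)"
    then have ij: "i < n" "j < n" by auto
    have Kc: "K $$ (k, j) = app n G (p j) k" if "k < n" for k
      using that ij c by (simp add: K_def Gm_def P_def scalar_prod_def app_def atLeast0LessThan)
    have "(transpose_mat P * K) $$ (i, j) = B (p i) (p j)"
      using ij c K Kc by (simp add: scalar_prod_def B_def dot_def P_def atLeast0LessThan)
    then show "(transpose_mat P * K) $$ (i, j) = (d \<cdot>\<^sub>m 1\<^sub>m n) $$ (i, j)"
      using ij p(2,3) by auto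
  qed (use c K in auto)
  moreover have "transpose_mat P * K = transpose_mat K * P"
    using c by (simp add: Kt) (simp add: K_def assoc_mult_mat[of _ n n _ n _ n])
  ultimately have "X * P = 1\<^sub>m n"
    using c K d by (simp add: X_def mult_smult_assoc_mat[of _ n n _ n]) (intro eq_matI, auto)
  moreover from this have PX: "P * X = 1\<^sub>m n" using mat_mult_left_right_inverse X c by blast
  moreover have img: "symmetric_mats n = (\<lambda>A. X * A * P) ` M"
  proof
    show "(\<lambda>A. X * A * P) ` M \<subseteq> symmetric_mats n"
    proof clarify
      fix A assume "A \<in> M"
      then obtain S where S: "S \<in> carrier_mat n n" "transpose_mat S = S" "A = S * Gm" by (auto simp: M_iff)
      have SK: "S * K \<in> carrier_mat n n" using S(1) K by simp
      have "X * A * P = X * (S * K)"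
        using S(1) X c by (simp add: S(3) K_def assoc_mult_mat[of _ n n _ n _ n])
      then have e: "X * A * P = (1 / d) \<cdot>\<^sub>m (transpose_mat K * (S * K))"
        using K SK by (simp add: X_def mult_smult_assoc_mat[of _ n n _ n])
      have "transpose_mat (transpose_mat K * (S * K)) = transpose_mat (S * K) * K"
        using K SK by (simp add: transpose_mult[of _ n n _ n])
      also have "transpose_mat (S * K) = transpose_mat K * S"
        using K S(1) by (simp add: transpose_mult[of _ n n _ n] S(2))
      also have "transpose_mat K * S * K = transpose_mat K * (S * K)"
        using K S(1) by (simp add: assoc_mult_mat[of _ n n _ n _ n])
      finally have t: "transpose_mat (transpose_mat K * (S * K)) = transpose_mat K * (S * K)" .
      have "transpose_mat (c \<cdot>\<^sub>m Z) = c \<cdot>\<^sub>m transpose_mat Z" for c :: 'a and Z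
        by (rule eq_matI) auto
      then show "X * A * P \<in> symmetric_mats n"
        using K SK unfolding e symmetric_mats_def by (simp add: t)
    qed
    show "symmetric_mats n \<subseteq> (\<lambda>A. X * A * P) ` M"
    proof
      fix R :: "'a mat" assume "R \<in> symmetric_mats n"
      then have R: "R \<in> carrier_mat n n" "transpose_mat R = R" by (auto simp: symmetric_mats_def)
      define S where "S = (1 / d) \<cdot>\<^sub>m (P * R * transpose_mat P)"
      have S: "S \<in> carrier_mat n n" using c R by (simp add: S_def)
      have PR: "P * R \<in> carrier_mat n n" using c R by simp
      have St: "transpose_mat S = S"
      proof -
        have "transpose_mat (P * R * transpose_mat P) = P * transpose_mat (P * R)"
          using c PR by (simp add: transpose_mult[of _ n n _ n])
        also have "transpose_mat (P * R) = R * transpose_mat P"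
          using c R by (simp add: transpose_mult[of _ n n _ n])
        also have "P * (R * transpose_mat P) = P * R * transpose_mat P"
          using c R by (simp add: assoc_mult_mat[of _ n n _ n _ n])
        finally have t: "transpose_mat (P * R * transpose_mat P) = P * R * transpose_mat P" .
        have "transpose_mat (c \<cdot>\<^sub>m Z) = c \<cdot>\<^sub>m transpose_mat Z" for c :: 'a and Z
          by (rule eq_matI) auto
        then show ?thesis by (simp add: S_def t)
      qed
      have "P * R * X = (1 / d) \<cdot>\<^sub>m (P * R * transpose_mat K)"
        using PR K by (simp add: X_def mult_smult_distrib[of _ n n _ n])
      also have "P * R * transpose_mat K = P * R * transpose_mat P * Gm"
        using PR c by (simp add: Kt assoc_mult_mat[of "P * R" n n _ n _ n])
      also have "(1 / d) \<cdot>\<^sub>m (P * R * transpose_mat P * Gm) = S * Gm"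
        using PR c by (simp add: S_def mult_smult_assoc_mat[of "P * R * transpose_mat P" n n _ n])
      finally have e: "P * R * X = S * Gm" .
      have "P * R * X \<in> M" unfolding e M_iff using S St by blast
      moreover have "X * (P * R * X) * P = (X * P) * R * (X * P)"
        using c R X by (simp add: assoc_mult_mat[of _ n n _ n _ n])
      then have "R = X * (P * R * X) * P" using \<open>X * P = 1\<^sub>m n\<close> R by simp
      ultimately show "R \<in> (\<lambda>A. X * A * P) ` M" by blast
    qed
  qed
  ultimately have sim: "similar_mat_sets n M (symmetric_mats n)"
    unfolding similar_mat_sets_def using X c by blast
  have "M = carrier_mat 1 1" if n1: "n = 1"
  proof
    show "M \<subseteq> carrier_mat 1 1" using Mc n1 by simp
    show "carrier_mat 1 1 \<subseteq> M"
    proof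
      fix A :: "'a mat" assume "A \<in> carrier_mat 1 1"
      then have A: "A \<in> carrier_mat n n" by (simp add: n1)
      have "X * A * P \<in> symmetric_mats n"
        unfolding symmetric_mats_def using X A c n1 by (auto intro!: eq_matI)
      then obtain A' where A': "A' \<in> M" "X * A * P = X * A' * P" using img by blast
      have undo: "P * (X * C * P) * X = C" if C: "C \<in> carrier_mat n n" for C
      proof -
        have "P * (X * C * P) * X = (P * X) * C * (P * X)"
          using c X C by (simp add: assoc_mult_mat[of _ n n _ n _ n])
        then show ?thesis using PX C by simp
      qed
      have "A = A'" using undo[OF A] undo[of A'] A' Mc by auto
      then show "A \<in> M" using A'(1) by simp
    qed
  qed
  then show ?thesis using sim by blast
qed

end
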